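(* Let $\lambda\in\partial\mathbb{D}$ be an irrational rotation, let $\phi\in H^\infty(\mathbb{D})$, $\phi\neq0$, and let $T=R_\lambda\phi(B)$ on $H^2(\mathbb{D})$. (1) If the sequence $\{\Omega_n\}_{n\ge1}$ is not uniformly bounded on compact subsets of $\mathbb{D}$ and $|\phi(0)|<1$, then $T$ is hypercyclic. (2) If the sequence $\{1/\Phi_n\}_{n\ge1}$ is not uniformly bounded on compact subsets of $\mathbb{D}$ and $|\phi(0)|>1$, then $T$ is hypercyclic.
   Context: $\mathbb{D}$ is the open unit disk, $H^2(\mathbb{D})$ the Hardy space. $B$ is the backward shift: $B1=0$, $Bz^n=z^{n-1}$ for $n\ge1$. $R_\lambda f(z)=f(\lambda z)$. For $\phi\in H^\infty(\mathbb{D})$ write $\overline{\phi}(z):=\overline{\phi(\overline{z})}\in H^\infty(\mathbb{D})$, and let $\phi(B):=M_{\overline{\phi}}^\star$, the adjoint of multiplication by $\overline{\phi}$ on $H^2(\mathbb{D})$ (i.e. $\sum_k c_kB^k$ if $\phi=\sum_k c_kz^k$). "$\lambda$ is an irrational rotation" means $\lambda=e^{2\pi i\theta}$ with $\theta\in\mathbb{R}$ irrational. Put $\omega=1/\overline{\lambda}$, and for $n\ge1$, $\Omega_n(z)=\overline{\phi}(\omega z)\cdots\overline{\phi}(\omega^nz)$ and $\Phi_n(z)=\phi(z)\phi(\lambda z)\cdots\phi(\lambda^{n-1}z)$, $z\in\mathbb{D}$. The function $1/\Phi_n$ is regarded as a meromorphic function on $\mathbb{D}$ (value $\infty$ at zeros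 of $\Phi_n$). A family is uniformly bounded on compact subsets if for each compact $K\subset\mathbb{D}$ there is a finite constant bounding the modulus of all its members on $K$. A bounded operator $T$ is hypercyclic if there is a vector $f$ whose orbit $\{T^nf:n\in\mathbb{N}\}$ is dense. *)

theory Defs
  imports "HOL-Complex_Analysis.Complex_Analysis" "HOL-Library.Extended_Nonnegative_Real"
begin

abbreviation unit_disc :: "complex set" where
  "unit_disc \<equiv> ball 0 1"

definition taylor_coeff :: "(complex \<Rightarrow> complex) \<Rightarrow> nat \<Rightarrow> complex" where
  "taylor_coeff f n = (deriv ^^ n) f 0 / fact n"

lemma taylor_coeff_add:
  assumes "f holomorphic_on unit_disc" "g holomorphic_on unit_disc"
  shows "taylor_coeff (\<lambda>z. f z + g z) n = taylor_coeff f n + taylor_coeff g n"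
  using higher_deriv_add[OF assms, of 0 n] by (simp add: taylor_coeff_def add_divide_distrib)

lemma taylor_coeff_cmult:
  assumes "f holomorphic_on unit_disc"
  shows "taylor_coeff (\<lambda>z. c * f z) n = c * taylor_coeff f n"
  using higher_deriv_cmult[OF assms, of 0 n c] by (simp add: taylor_coeff_def)

lemma taylor_coeff_zero: "taylor_coeff (\<lambda>_. 0) n = 0"
  by (simp add: taylor_coeff_def)

lemma taylor_coeff_inject:
  assumes "f holomorphic_on unit_disc" "g holomorphic_on unit_disc"
    and "\<And>n. taylor_coeff f n = taylor_coeff g n" and "z \<in> unit_disc"
  shows "f z = g z"
  using holomorphic_fun_eq_on_ball[OF assms(1,2,4)] assms(3) by (simp add: taylor_coeff_def)

lemma square_summable_add:
  fixes a b :: "nat \<Rightarrow> complex"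
  assumes "summable (\<lambda>n. (norm (a n))\<^sup>2)" "summable (\<lambda>n. (norm (b n))\<^sup>2)"
  shows "summable (\<lambda>n. (norm (a n + b n))\<^sup>2)"
proof (rule summable_comparison_test')
  show "summable (\<lambda>n. 2 * (norm (a n))\<^sup>2 + 2 * (norm (b n))\<^sup>2)"
    by (intro summable_add summable_mult assms)
  fix n
  have "(norm (a n + b n))\<^sup>2 \<le> (norm (a n) + norm (b n))\<^sup>2"
    by (intro power_mono norm_triangle_ineq) auto
  also have "\<dots> \<le> 2 * (norm (a n))\<^sup>2 + 2 * (norm (b n))\<^sup>2"
    using sum_squares_bound[of "norm (a n)" "norm (b n)"] by (simp add: power2_sum)
  finally show "norm ((norm (a n + b n))\<^sup>2) \<le> 2 * (norm (a n))\<^sup>2 + 2 * (norm (b n))\<^sup>2"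
    by simp
qed

lemma square_summable_mult:
  fixes a b :: "nat \<Rightarrow> complex"
  assumes "summable (\<lambda>n. (norm (a n))\<^sup>2)" "summable (\<lambda>n. (norm (b n))\<^sup>2)"
  shows "summable (\<lambda>n. a n * cnj (b n))"
proof (rule summable_comparison_test')
  show "summable (\<lambda>n. (norm (a n))\<^sup>2 + (norm (b n))\<^sup>2)"
    by (intro summable_add assms)
  fix n
  show "norm (a n * cnj (b n)) \<le> (norm (a n))\<^sup>2 + (norm (b n))\<^sup>2"
    using sum_squares_bound[of "norm (a n)" "norm (b n)"]
      mult_nonneg_nonneg[OF norm_ge_zero norm_ge_zero, of "a n" "b n"]
    unfolding norm_mult complex_mod_cnj by linarith
qed

text \<open>
  The Hardy space on the unit disc as a type. Its elements are the functions holomorphic on the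
  disc with square-summable Taylor coefficients. They are normalised to be zero off the disc,
  so that equality in the type is equality of functions on the disc.
\<close>

typedef hardy2 = "{f :: complex \<Rightarrow> complex. f holomorphic_on unit_disc \<and>
    summable (\<lambda>n. (norm (taylor_coeff f n))\<^sup>2) \<and> (\<forall>z. z \<notin> unit_disc \<longrightarrow> f z = 0)}"
  morphisms h2_fun Abs_hardy2
  by (rule exI[of _ "\<lambda>_. 0"]) (simp add: taylor_coeff_zero)

setup_lifting type_definition_hardy2

text \<open>
  The element of the Hardy space that agrees on the disc with a given function.
  Nothing is said about it if that function is not in the Hardy space.
\<close>

definition h2_of :: "(complex \<Rightarrow> complex) \<Rightarrow> hardy2" where
  "h2_of f = Abs_hardy2 (\<lambda>z. if z \<in> unit_disc then f z else 0)"

definition h2_coeff :: "hardy2 \<Rightarrow> nat \<Rightarrow> complex" where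
  "h2_coeff f = taylor_coeff (h2_fun f)"

lemma h2_fun_holomorphic: "h2_fun f holomorphic_on unit_disc"
  using h2_fun[of f] by simp

lemma h2_coeff_summable: "summable (\<lambda>n. (norm (h2_coeff f n))\<^sup>2)"
  using h2_fun[of f] by (simp add: h2_coeff_def)

lemma h2_fun_outside: "z \<notin> unit_disc \<Longrightarrow> h2_fun f z = 0"
  using h2_fun[of f] by simp

lemma h2_fun_h2_of:
  assumes "f holomorphic_on unit_disc" "summable (\<lambda>n. (norm (taylor_coeff f n))\<^sup>2)"
    and "z \<in> unit_disc"
  shows "h2_fun (h2_of f) z = f z"
proof -
  let ?g = "\<lambda>z. if z \<in> unit_disc then f z else 0"
  have "eventually (\<lambda>w. w \<in> unit_disc) (nhds (0::complex))"
    by (intro eventually_nhds_in_open) auto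
  then have "eventually (\<lambda>w. ?g w = f w) (nhds 0)"
    by eventually_elim simp
  then have "(deriv ^^ n) ?g 0 = (deriv ^^ n) f 0" for n
    by (intro higher_deriv_cong_ev refl)
  then have "taylor_coeff ?g = taylor_coeff f"
    by (simp add: taylor_coeff_def fun_eq_iff)
  moreover have "?g holomorphic_on unit_disc"
    using assms(1) by (rule holomorphic_transform) simp
  ultimately show ?thesis
    using assms by (simp add: h2_of_def Abs_hardy2_inverse)
qed

lemma h2_coeff_inject:
  assumes "\<And>n. h2_coeff f n = h2_coeff g n"
  shows "f = g"
proof -
  have "h2_fun f z = h2_fun g z" for z
    using taylor_coeff_inject[OF h2_fun_holomorphic[of f] h2_fun_holomorphic[of g]] assms
      h2_fun_outside[of z f] h2_fun_outside[of z g]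
    by (cases "z \<in> unit_disc") (auto simp: h2_coeff_def)
  then show ?thesis
    by (simp add: h2_fun_inject[symmetric] fun_eq_iff)
qed

lemma h2_cmult_closed:
  assumes "f holomorphic_on unit_disc \<and> summable (\<lambda>n. (norm (taylor_coeff f n))\<^sup>2) \<and>
    (\<forall>z. z \<notin> unit_disc \<longrightarrow> f z = 0)"
  shows "(\<lambda>z. c * f z) holomorphic_on unit_disc \<and>
    summable (\<lambda>n. (norm (taylor_coeff (\<lambda>z. c * f z) n))\<^sup>2) \<and>
    (\<forall>z. z \<notin> unit_disc \<longrightarrow> c * f z = 0)"
  using assms
  by (auto simp: taylor_coeff_cmult norm_mult power_mult_distrib intro: holomorphic_intros summable_mult)

lift_definition h2_cscale :: "complex \<Rightarrow> hardy2 \<Rightarrow> hardy2" is "\<lambda>c f z. c * f z"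
  by (rule h2_cmult_closed)

text \<open>The complex inner product, linear in the first argument.\<close>

definition h2_cinner :: "hardy2 \<Rightarrow> hardy2 \<Rightarrow> complex" where
  "h2_cinner f g = (\<Sum>n. h2_coeff f n * cnj (h2_coeff g n))"

instantiation hardy2 :: real_inner
begin

lift_definition zero_hardy2 :: hardy2 is "\<lambda>_. 0"
  by (simp add: taylor_coeff_zero)

lift_definition plus_hardy2 :: "hardy2 \<Rightarrow> hardy2 \<Rightarrow> hardy2" is "\<lambda>f g z. f z + g z"
  by (auto simp: taylor_coeff_add intro: holomorphic_intros square_summable_add)

definition uminus_hardy2 :: "hardy2 \<Rightarrow> hardy2" where
  "uminus_hardy2 f = h2_cscale (-1) f"

definition minus_hardy2 :: "hardy2 \<Rightarrow> hardy2 \<Rightarrow> hardy2" where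
  "minus_hardy2 f g = f + (- g)"

definition scaleR_hardy2 :: "real \<Rightarrow> hardy2 \<Rightarrow> hardy2" where
  "scaleR_hardy2 r f = h2_cscale (of_real r) f"

definition norm_hardy2 :: "hardy2 \<Rightarrow> real" where
  "norm_hardy2 f = sqrt (\<Sum>n. (norm (h2_coeff f n))\<^sup>2)"

definition inner_hardy2 :: "hardy2 \<Rightarrow> hardy2 \<Rightarrow> real" where
  "inner_hardy2 f g = Re (h2_cinner f g)"

definition sgn_hardy2 :: "hardy2 \<Rightarrow> hardy2" where
  "sgn_hardy2 f = inverse (norm f) *\<^sub>R f"

definition dist_hardy2 :: "hardy2 \<Rightarrow> hardy2 \<Rightarrow> real" where
  "dist_hardy2 f g = norm (f - g)"

definition uniformity_hardy2 :: "(hardy2 \<times> hardy2) filter" where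
  "uniformity_hardy2 = (INF e\<in>{0 <..}. principal {(f, g). dist f g < e})"

definition open_hardy2 :: "hardy2 set \<Rightarrow> bool" where
  "open_hardy2 U \<longleftrightarrow> (\<forall>f\<in>U. eventually (\<lambda>(f', g). f' = f \<longrightarrow> g \<in> U) uniformity)"

lemma h2_coeff_plus: "h2_coeff (f + g) n = h2_coeff f n + h2_coeff g n"
  by (simp add: h2_coeff_def plus_hardy2.rep_eq taylor_coeff_add h2_fun_holomorphic)

lemma h2_coeff_cscale: "h2_coeff (h2_cscale c f) n = c * h2_coeff f n"
  by (simp add: h2_coeff_def h2_cscale.rep_eq taylor_coeff_cmult h2_fun_holomorphic)

lemma h2_coeff_zero: "h2_coeff 0 n = 0"
  by (simp add: h2_coeff_def zero_hardy2.rep_eq taylor_coeff_zero)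

lemma h2_cinner_self: "h2_cinner f f = of_real (\<Sum>n. (norm (h2_coeff f n))\<^sup>2)"
proof -
  have "h2_cinner f f = (\<Sum>n. of_real ((norm (h2_coeff f n))\<^sup>2))"
    unfolding h2_cinner_def by (simp only: complex_norm_square)
  then show ?thesis
    by (simp only: suminf_of_real[OF h2_coeff_summable])
qed

lemma h2_cinner_plus_left: "h2_cinner (f + g) h = h2_cinner f h + h2_cinner g h"
  unfolding h2_cinner_def h2_coeff_plus distrib_right
  by (intro suminf_add[symmetric] square_summable_mult h2_coeff_summable)

lemma h2_cinner_cscale_left: "h2_cinner (h2_cscale c f) g = c * h2_cinner f g"
  unfolding h2_cinner_def h2_coeff_cscale mult.assoc
  by (intro suminf_mult square_summable_mult h2_coeff_summable)

lemma h2_cinner_commute: "h2_cinner f g = cnj (h2_cinner g f)"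
proof -
  have "(\<lambda>n. h2_coeff g n * cnj (h2_coeff f n)) sums h2_cinner g f"
    unfolding h2_cinner_def by (intro summable_sums square_summable_mult h2_coeff_summable)
  then have "(\<lambda>n. h2_coeff f n * cnj (h2_coeff g n)) sums cnj (h2_cinner g f)"
    using sums_cnj[of "\<lambda>n. h2_coeff g n * cnj (h2_coeff f n)" "h2_cinner g f"]
    by (simp add: mult.commute)
  then show ?thesis
    unfolding h2_cinner_def[of f g] by (simp add: sums_iff)
qed

instance
proof
  fix f g h :: hardy2 and r s :: real
  show "f + g + h = f + (g + h)" "f + g = g + f" "0 + f = f"
    "- f + f = 0" "f - g = f + - g"
    "r *\<^sub>R (f + g) = r *\<^sub>R f + r *\<^sub>R g" "(r + s) *\<^sub>R f = r *\<^sub>R f + s *\<^sub>R f"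
    "r *\<^sub>R s *\<^sub>R f = (r * s) *\<^sub>R f" "1 *\<^sub>R f = f"
    by (rule h2_coeff_inject; simp add: minus_hardy2_def uminus_hardy2_def scaleR_hardy2_def
        h2_coeff_plus h2_coeff_cscale h2_coeff_zero algebra_simps)+
  show "sgn f = inverse (norm f) *\<^sub>R f"
    by (rule sgn_hardy2_def)
  show "dist f g = norm (f - g)"
    by (rule dist_hardy2_def)
  show "uniformity = (INF e\<in>{0 <..}. principal {(f :: hardy2, g). dist f g < e})"
    by (rule uniformity_hardy2_def)
  show "open U \<longleftrightarrow> (\<forall>f\<in>U. eventually (\<lambda>(f', g). f' = f \<longrightarrow> g \<in> U) uniformity)"
    for U :: "hardy2 set"
    by (rule open_hardy2_def)
  show "inner f g = inner g f"
    unfolding inner_hardy2_def by (subst h2_cinner_commute) simp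
  show "inner (f + g) h = inner f h + inner g h"
    by (simp add: inner_hardy2_def h2_cinner_plus_left)
  show "inner (r *\<^sub>R f) g = r * inner f g"
    by (simp add: inner_hardy2_def scaleR_hardy2_def h2_cinner_cscale_left)
  have self: "inner f f = (\<Sum>n. (norm (h2_coeff f n))\<^sup>2)"
    by (simp add: inner_hardy2_def h2_cinner_self)
  show "0 \<le> inner f f"
    unfolding self by (intro suminf_nonneg h2_coeff_summable) simp
  show "inner f f = 0 \<longleftrightarrow> f = 0"
    unfolding self using suminf_eq_zero_iff[OF h2_coeff_summable[of f]] h2_coeff_inject[of f 0]
    by (auto simp: h2_coeff_zero)
  show "norm f = sqrt (inner f f)"
    by (simp add: self norm_hardy2_def)
qed

end

definition H_infinity :: "(complex \<Rightarrow> complex) set" where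
  "H_infinity = {\<phi>. \<phi> holomorphic_on unit_disc \<and> bounded (\<phi> ` unit_disc)}"

definition conj_symbol :: "(complex \<Rightarrow> complex) \<Rightarrow> complex \<Rightarrow> complex" where
  "conj_symbol \<phi> z = cnj (\<phi> (cnj z))"

definition mult_op :: "(complex \<Rightarrow> complex) \<Rightarrow> hardy2 \<Rightarrow> hardy2" where
  "mult_op \<phi> f = h2_of (\<lambda>z. \<phi> z * h2_fun f z)"

definition rotation_op :: "complex \<Rightarrow> hardy2 \<Rightarrow> hardy2" where
  "rotation_op lam f = h2_of (\<lambda>z. h2_fun f (lam * z))"

text \<open>
  The library constant \<^const>\<open>adjoint\<close> refers to the real inner product.
  Here the adjoint is taken with respect to the complex one.
\<close>

definition h2_adjoint :: "(hardy2 \<Rightarrow> hardy2) \<Rightarrow> hardy2 \<Rightarrow> hardy2" where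
  "h2_adjoint A g = (THE h. \<forall>f. h2_cinner (A f) g = h2_cinner f h)"

text \<open>The function \<open>\<phi>(B)\<close> of the backward shift \<open>B\<close>.\<close>

definition backward_shift_calculus :: "(complex \<Rightarrow> complex) \<Rightarrow> hardy2 \<Rightarrow> hardy2" where
  "backward_shift_calculus \<phi> = h2_adjoint (mult_op (conj_symbol \<phi>))"

definition bounded_operator :: "(hardy2 \<Rightarrow> hardy2) \<Rightarrow> bool" where
  "bounded_operator T \<longleftrightarrow> bounded_linear T \<and> (\<forall>c f. T (h2_cscale c f) = h2_cscale c (T f))"

definition hypercyclic :: "(hardy2 \<Rightarrow> hardy2) \<Rightarrow> bool" where
  "hypercyclic T \<longleftrightarrow> bounded_operator T \<and> (\<exists>f. closure (range (\<lambda>n. (T ^^ n) f)) = UNIV)"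

definition irrational_rotation :: "complex \<Rightarrow> bool" where
  "irrational_rotation lam \<longleftrightarrow> (\<exists>\<theta>::real. \<theta> \<notin> \<rat> \<and> lam = exp (2 * of_real pi * \<i> * of_real \<theta>))"

definition Omega :: "complex \<Rightarrow> (complex \<Rightarrow> complex) \<Rightarrow> nat \<Rightarrow> complex \<Rightarrow> complex" where
  "Omega lam \<phi> n z = (\<Prod>j=1..n. conj_symbol \<phi> ((1 / cnj lam) ^ j * z))"

definition Phi :: "complex \<Rightarrow> (complex \<Rightarrow> complex) \<Rightarrow> nat \<Rightarrow> complex \<Rightarrow> complex" where
  "Phi lam \<phi> n z = (\<Prod>j<n. \<phi> (lam ^ j * z))"

text \<open>
  Uniform boundedness on compact subsets of the disc, for a sequence indexed from 1. The sequence
  is given through its moduli, in \<^typ>\<open>ennreal\<close>, because a meromorphic function has modulus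
  \<open>\<infinity>\<close> at its poles.
\<close>

definition unif_bounded_on_compacts :: "(nat \<Rightarrow> complex \<Rightarrow> ennreal) \<Rightarrow> bool" where
  "unif_bounded_on_compacts m \<longleftrightarrow>
    (\<forall>K. compact K \<and> K \<subseteq> unit_disc \<longrightarrow>
      (\<exists>C::real. \<forall>n\<ge>1. \<forall>z\<in>K. m n z \<le> ennreal C))"

text \<open>In \<^typ>\<open>ennreal\<close>, the inverse of \<open>0\<close> is \<open>\<infinity>\<close>.\<close>

definition recip_modulus :: "(complex \<Rightarrow> complex) \<Rightarrow> complex \<Rightarrow> ennreal" where
  "recip_modulus f z = inverse (ennreal (norm (f z)))"

end

theory Submission
  imports Defs
begin

text \<open>
  Write \<open>\<psi>\<close> for the symbol with conjugated coefficients. The adjoint of \<open>T\<close> is \<open>S = M\<^sub>\<psi> R\<close>, with \<open>R\<close>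
  the rotation by the conjugate of \<open>\<lambda>\<close>, so \<open>S\<^sup>n g\<close> is, up to a rotation of the variable, the product
  \<open>\<Omega>\<^sub>n g\<close>. By solving \<open>u + S\<^sup>N T\<^sup>N u = x\<close> one reduces hypercyclicity of \<open>T\<close> to a statement about
  bounded sequences in the Hardy space: along some sequence \<open>N\<^sub>k\<close>, if both \<open>h\<^sub>k\<close> and
  \<open>f\<^sub>k = S\<^bsup>N\<^sub>k\<^esup> h\<^sub>k\<close> are bounded, then both tend weakly to 0. By Montel's theorem it is enough that
  every locally uniform limit of either sequence vanishes.

  If \<open>|\<phi>(0)| < 1\<close>, then \<open>f\<^sub>k\<close> tends to 0 near the origin. A nonzero limit of \<open>h\<^sub>k\<close> would be bounded
  below on some circle, where \<open>\<Omega>\<^sub>n h\<^sub>k\<close> is bounded; so the \<open>\<Omega>\<^sub>n\<close> would be bounded inside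
  that circle. If \<open>|\<phi>(0)| > 1\<close>, the two roles are exchanged, with \<open>1/\<Phi>\<^sub>n\<close> in place of \<open>\<Omega>\<^sub>n\<close>.
  When \<open>\<phi>\<close> has a zero \<open>a\<close>, a limit of the \<open>f\<^sub>k\<close> vanishes on the infinite orbit of the conjugate of
  \<open>a\<close> under the rotation, and so is 0.
\<close>

section \<open>A criterion for dense orbits\<close>

text \<open>Birkhoff's transitivity theorem. For \<open>d\<close> in the countable set
  \<open>D\<close> and each \<open>j\<close>, the vectors whose orbit meets the ball of radius
  \<open>1 / (j + 1)\<close> around \<open>d\<close> form an open set, and transitivity makes it
  dense. By Baire's theorem these countably many sets have a common point, whose orbit comes
  arbitrarily close to every point of \<open>D\<close>.\<close>

lemma dense_orbit_if_transitive:
  fixes T :: "'a::complete_space \<Rightarrow> 'a"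
  assumes cont: "continuous_on UNIV T"
    and D: "countable D" "closure D = (UNIV :: 'a set)"
    and trans: "\<And>x y e. e > 0 \<Longrightarrow> \<exists>u n. dist u x < e \<and> dist ((T ^^ n) u) y < e"
  shows "\<exists>f. closure (range (\<lambda>n. (T ^^ n) f)) = UNIV"
proof -
  have contn: "continuous_on UNIV (T ^^ n)" for n
  proof (induction n)
    case (Suc n)
    then show ?case
      using continuous_on_compose2[OF cont Suc] by (simp add: o_def)
  qed (simp add: id_def)
  define G where "G = (\<lambda>(d :: 'a, j :: nat). \<Union>n. (T ^^ n) -` ball d (inverse (real (Suc j))))"
  have op: "open (G p)" for p
    unfolding G_def using contn
    by (auto split: prod.splits intro!: open_UN open_vimage)
  have dense: "closure (G p) = UNIV" for p
  proof -
    obtain d j where p: "p = (d, j)" by fastforce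
    have "\<exists>u\<in>G p. dist u x < e" if "e > 0" for x e
    proof -
      have "min e (inverse (real (Suc j))) > 0" using that by simp
      from trans[OF this, of x d] obtain u n where
        "dist u x < e" "dist ((T ^^ n) u) d < inverse (real (Suc j))"
        by auto
      then show ?thesis by (auto simp: p G_def dist_commute intro!: bexI[of _ u] exI[of _ n])
    qed
    then show ?thesis by (auto simp: closure_approachable)
  qed
  have "euclidean closure_of \<Inter>(G ` (D \<times> UNIV)) = topspace euclidean"
  proof (rule Baire_category)
    show "completely_metrizable_space (euclidean :: 'a topology) \<or>
        locally_compact_space (euclidean :: 'a topology) \<and> regular_space (euclidean :: 'a topology)"
      using completely_metrizable_space_euclidean by blast
    show "countable (G ` (D \<times> UNIV))"
      using D by (intro countable_image countable_SIGMA) auto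
  qed (use op dense in \<open>auto simp flip: closure_of_UNIV\<close>)
  then have "\<Inter>(G ` (D \<times> UNIV)) \<noteq> {}"
    by (metis UNIV_not_empty closure_of_empty topspace_euclidean)
  then obtain f where f: "\<And>d j. d \<in> D \<Longrightarrow> f \<in> G (d, j)"
    by blast
  have "\<exists>u\<in>range (\<lambda>n. (T ^^ n) f). dist u y < e" if e: "e > 0" for y e
  proof -
    have "\<exists>d\<in>D. dist d y < e / 2"
      using D(2) e closure_approachable[of y D] by (metis UNIV_I half_gt_zero)
    then obtain d where d: "d \<in> D" "dist d y < e / 2" by blast
    obtain j where j: "inverse (real (Suc j)) < e / 2"
      using reals_Archimedean[OF half_gt_zero[OF e]] by blast
    obtain n where "dist d ((T ^^ n) f) < inverse (real (Suc j))"
      using f[OF d(1), of j] by (auto simp: G_def)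
    then have "dist ((T ^^ n) f) y < e"
      using dist_triangle3[of "(T ^^ n) f" y d] d j by linarith
    then show ?thesis by blast
  qed
  then show ?thesis by (auto simp: closure_approachable intro!: exI[of _ f])
qed

text \<open>The damped iteration \<open>F\<close> is a contraction with factor \<open>1 - t\<close>.
  Since \<open>t > 0\<close>, its fixed point given by Banach's theorem solves the equation.\<close>

lemma identity_plus_positive_surjective:
  fixes A A' :: "'a::{real_inner, complete_space} \<Rightarrow> 'a"
  assumes A: "bounded_linear A" and A': "bounded_linear A'"
    and adj: "\<And>x y. inner (A x) y = inner x (A' y)"
  obtains x where "x + A' (A x) = b"
proof -
  interpret A: bounded_linear A by fact
  interpret A': bounded_linear A' by fact
  obtain M where M: "M > 0" "\<And>x. norm (A' x) \<le> norm x * M"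
    using A'.pos_bounded by blast
  \<comment> \<open>This choice gives \<open>t * M\<^sup>2 = 1 - t\<close>. Then
    \<open>t\<^sup>2 |A' (A v)|\<^sup>2\<close> is at most \<open>t (1 - t) |A v|\<^sup>2\<close>,
    half of what the cross term in the expanded square subtracts.\<close>
  define t where "t = 1 / (1 + M\<^sup>2)"
  have "1 + M\<^sup>2 > 0" by (simp add: add_pos_nonneg)
  then have t: "t > 0" "t \<le> 1" "t * M\<^sup>2 = 1 - t"
    by (auto simp: t_def divide_simps)
  define F where "F x = x - t *\<^sub>R (x + A' (A x) - b)" for x
  have contraction: "norm ((1 - t) *\<^sub>R v - t *\<^sub>R A' (A v)) \<le> (1 - t) * norm v" for v
  proof -
    have "inner v (A' (A v)) = (norm (A v))\<^sup>2"
      using adj[of v "A v"] by (simp add: power2_norm_eq_inner)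
    then have "(norm ((1 - t) *\<^sub>R v - t *\<^sub>R A' (A v)))\<^sup>2 =
        (1 - t)\<^sup>2 * (norm v)\<^sup>2 - 2 * t * (1 - t) * (norm (A v))\<^sup>2 + t\<^sup>2 * (norm (A' (A v)))\<^sup>2"
      unfolding power2_norm_eq_inner
      by (simp add: inner_diff_left inner_diff_right inner_commute power2_eq_square algebra_simps)
    also have "t\<^sup>2 * (norm (A' (A v)))\<^sup>2 \<le> t\<^sup>2 * (norm (A v) * M)\<^sup>2"
      using M by (intro mult_left_mono power_mono) auto
    also have "\<dots> = t * (1 - t) * (norm (A v))\<^sup>2"
      unfolding t(3)[symmetric] by (simp add: power2_eq_square algebra_simps)
    also have "(1 - t)\<^sup>2 * (norm v)\<^sup>2 - 2 * t * (1 - t) * (norm (A v))\<^sup>2 + t * (1 - t) * (norm (A v))\<^sup>2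
        = (1 - t)\<^sup>2 * (norm v)\<^sup>2 - t * (1 - t) * (norm (A v))\<^sup>2"
      by (simp add: algebra_simps)
    also have "\<dots> \<le> ((1 - t) * norm v)\<^sup>2"
      using t by (simp add: power_mult_distrib)
    finally show ?thesis
      using t by (auto intro: power2_le_imp_le)
  qed
  have "dist (F x) (F y) \<le> (1 - t) * dist x y" for x y
  proof -
    have "F x - F y = (1 - t) *\<^sub>R (x - y) - t *\<^sub>R A' (A (x - y))"
      by (simp add: F_def A.diff A'.diff algebra_simps)
    then show ?thesis using contraction[of "x - y"] by (simp add: dist_norm)
  qed
  then have "\<exists>!x. F x = x"
    using t by (intro banach_fix_type[of "1 - t"]) auto
  then obtain x where "F x = x" by blast
  then have "x + A' (A x) = b" using t by (simp add: F_def)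
  then show ?thesis by (rule that)
qed

lemma funpow_adjoint:
  fixes T S :: "'a::real_inner \<Rightarrow> 'a"
  assumes "\<And>x y. inner (T x) y = inner x (S y)"
  shows "inner ((T ^^ n) x) y = inner x ((S ^^ n) y)"
proof (induction n arbitrary: y)
  case (Suc n)
  have "inner ((T ^^ Suc n) x) y = inner ((T ^^ n) x) (S y)" by (simp add: assms)
  also have "\<dots> = inner x ((S ^^ Suc n) y)" by (simp add: Suc funpow_swap1)
  finally show ?case .
qed simp

lemma bounded_linear_funpow:
  fixes T :: "'a::real_normed_vector \<Rightarrow> 'a"
  assumes "bounded_linear T"
  shows "bounded_linear (T ^^ n)"
proof (induction n)
  case (Suc n)
  then show ?case using bounded_linear_compose[OF assms Suc] by (simp add: o_def)
qed (simp add: id_def)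

text \<open>Pairing the equation with \<open>x\<close> gives the energy identity, and Cauchy-Schwarz
  turns it into the two norm bounds.\<close>

lemma resolvent_solution:
  fixes A A' :: "'a::{real_inner, complete_space} \<Rightarrow> 'a"
  assumes A: "bounded_linear A" and A': "bounded_linear A'"
    and adj: "\<And>x y. inner (A x) y = inner x (A' y)"
  obtains x where "x + A' (A x) = b" "(norm x)\<^sup>2 + (norm (A x))\<^sup>2 = inner x b"
    "norm x \<le> norm b" "norm (A x) \<le> norm b"
proof -
  obtain x where x: "x + A' (A x) = b"
    using identity_plus_positive_surjective[OF assms] .
  have eq: "(norm x)\<^sup>2 + (norm (A x))\<^sup>2 = inner x b"
    unfolding x[symmetric] by (simp add: inner_add_right adj[symmetric] power2_norm_eq_inner)
  have le: "inner x b \<le> norm x * norm b" by (rule norm_cauchy_schwarz)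
  have "norm x * norm x \<le> norm x * norm b"
    using eq le zero_le_power2[of "norm (A x)"] unfolding power2_eq_square by linarith
  then have nx: "norm x \<le> norm b"
    by (cases "x = 0") (auto simp: mult_le_cancel_left)
  have "(norm (A x))\<^sup>2 \<le> norm x * norm b"
    using eq le zero_le_power2[of "norm x"] by linarith
  also have "\<dots> \<le> (norm b)\<^sup>2"
    using nx by (simp add: power2_eq_square mult_right_mono)
  finally have "norm (A x) \<le> norm b" by (rule power2_le_imp_le) simp
  with x eq nx show ?thesis by (rule that)
qed

lemma tendsto_zero_power2:
  fixes f :: "nat \<Rightarrow> 'a::real_normed_vector"
  assumes "\<And>k. (norm (f k))\<^sup>2 \<le> c k" "c \<longlonglongrightarrow> (0::real)"
  shows "f \<longlonglongrightarrow> 0"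
proof -
  have "(\<lambda>k. (norm (f k))\<^sup>2) \<longlonglongrightarrow> 0"
    by (rule tendsto_sandwich[OF _ _ tendsto_const assms(2)]) (auto simp: assms(1))
  then have "(\<lambda>k. sqrt ((norm (f k))\<^sup>2)) \<longlonglongrightarrow> sqrt 0" by (intro tendsto_intros)
  then show ?thesis by (simp add: tendsto_norm_zero_iff)
qed

text \<open>
  With \<open>A = T\<^sup>N\<close> and \<open>u = (I + A\<^sup>* A)\<^sup>-\<^sup>1 x\<close>, the vector \<open>x - u\<close> is the image of a bounded
  vector under \<open>A\<^sup>*\<close> and is bounded itself. If that forces it to tend weakly to 0, then
  \<open>|x - u|\<^sup>2 + |A u|\<^sup>2 = (x - u, x)\<close> tends to 0. Dually, \<open>g = (I + A A\<^sup>*)\<^sup>-\<^sup>1 y\<close> gives a null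
  sequence \<open>A\<^sup>* g\<close> whose image under \<open>A\<close> tends to \<open>y\<close>.
\<close>

lemma dense_orbit_criterion:
  fixes T S :: "'a::{real_inner, complete_space} \<Rightarrow> 'a" and N :: "nat \<Rightarrow> nat"
  assumes T: "bounded_linear T" and S: "bounded_linear S"
    and adj: "\<And>x y. inner (T x) y = inner x (S y)"
    and D: "countable D" "closure D = (UNIV :: 'a set)"
    and image_null: "\<And>h y. bounded (range h) \<Longrightarrow> bounded (range (\<lambda>k. (S ^^ N k) (h k))) \<Longrightarrow>
        (\<lambda>k. inner ((S ^^ N k) (h k)) y) \<longlonglongrightarrow> 0"
    and preimage_null: "\<And>h y. bounded (range h) \<Longrightarrow> bounded (range (\<lambda>k. (S ^^ N k) (h k))) \<Longrightarrow>
        (\<lambda>k. inner (h k) y) \<longlonglongrightarrow> 0"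
  shows "\<exists>f. closure (range (\<lambda>n. (T ^^ n) f)) = UNIV"
proof (rule dense_orbit_if_transitive[OF _ D])
  show "continuous_on UNIV T" using T by (simp add: linear_continuous_on)
  note Tn = bounded_linear_funpow[OF T] and Sn = bounded_linear_funpow[OF S]
  note adjn = funpow_adjoint[OF adj]
  have adjn': "inner ((S ^^ n) x) y = inner x ((T ^^ n) y)" for n x y
    using adjn[of n y x] by (simp add: inner_commute)
  fix x y :: 'a and e :: real
  assume e: "e > 0"
  have "\<forall>k. \<exists>u. u + (S ^^ N k) ((T ^^ N k) u) = x \<and>
      (norm u)\<^sup>2 + (norm ((T ^^ N k) u))\<^sup>2 = inner u x \<and> norm u \<le> norm x \<and> norm ((T ^^ N k) u) \<le> norm x"
    using resolvent_solution[OF Tn Sn adjn] by metis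
  then obtain u where u: "\<And>k. u k + (S ^^ N k) ((T ^^ N k) (u k)) = x"
    "\<And>k. (norm (u k))\<^sup>2 + (norm ((T ^^ N k) (u k)))\<^sup>2 = inner (u k) x"
    "\<And>k. norm (u k) \<le> norm x" "\<And>k. norm ((T ^^ N k) (u k)) \<le> norm x"
    by metis
  have Su: "(S ^^ N k) ((T ^^ N k) (u k)) = x - u k" for k
    using u(1)[of k] by (metis add_diff_cancel_left')
  have bu: "norm (x - u k) \<le> norm x + norm x" for k
    using norm_triangle_ineq4[of x "u k"] u(3)[of k] by linarith
  have "(\<lambda>k. inner ((S ^^ N k) ((T ^^ N k) (u k))) x) \<longlonglongrightarrow> 0"
  proof (rule image_null)
    show "bounded (range (\<lambda>k. (T ^^ N k) (u k)))"
      using u(4) by (auto simp: bounded_iff)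
    show "bounded (range (\<lambda>k. (S ^^ N k) ((T ^^ N k) (u k))))"
      unfolding Su using bu by (auto simp: bounded_iff)
  qed
  then have null: "(\<lambda>k. inner (x - u k) x) \<longlonglongrightarrow> 0" by (simp only: Su)
  \<comment> \<open>Expand the first square and replace
    \<open>|u k|\<^sup>2 + |T\<^sup>N (u k)|\<^sup>2\<close> by the energy identity
    \<open>u(2)\<close>.\<close>
  have eq: "(norm (x - u k))\<^sup>2 + (norm ((T ^^ N k) (u k)))\<^sup>2 = inner (x - u k) x" for k
    using u(2)[of k] by (simp add: power2_norm_eq_inner algebra_simps inner_commute)
  have "(\<lambda>k. x - u k) \<longlonglongrightarrow> 0"
    using eq by (intro tendsto_zero_power2[OF _ null]) (metis le_add_same_cancel1 zero_le_power2)
  then have u_lim: "u \<longlonglongrightarrow> x"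
    using tendsto_diff[OF tendsto_const[of x]] by fastforce
  have Tu_lim: "(\<lambda>k. (T ^^ N k) (u k)) \<longlonglongrightarrow> 0"
    using eq by (intro tendsto_zero_power2[OF _ null]) (metis le_add_same_cancel2 zero_le_power2)
  have "\<forall>k. \<exists>g. g + (T ^^ N k) ((S ^^ N k) g) = y \<and>
      (norm g)\<^sup>2 + (norm ((S ^^ N k) g))\<^sup>2 = inner g y \<and> norm g \<le> norm y \<and> norm ((S ^^ N k) g) \<le> norm y"
    using resolvent_solution[OF Sn Tn adjn'] by metis
  then obtain g where g: "\<And>k. g k + (T ^^ N k) ((S ^^ N k) (g k)) = y"
    "\<And>k. (norm (g k))\<^sup>2 + (norm ((S ^^ N k) (g k)))\<^sup>2 = inner (g k) y"
    "\<And>k. norm (g k) \<le> norm y" "\<And>k. norm ((S ^^ N k) (g k)) \<le> norm y"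
    by metis
  have null': "(\<lambda>k. inner (g k) y) \<longlonglongrightarrow> 0"
    using g(3,4) by (intro preimage_null) (auto simp: bounded_iff)
  have "g \<longlonglongrightarrow> 0"
    using g(2) by (intro tendsto_zero_power2[OF _ null']) (metis le_add_same_cancel1 zero_le_power2)
  then have "(\<lambda>k. y - g k) \<longlonglongrightarrow> y - 0" by (intro tendsto_intros)
  then have TS_lim: "(\<lambda>k. (T ^^ N k) ((S ^^ N k) (g k))) \<longlonglongrightarrow> y"
    unfolding diff_zero by (rule Lim_transform_eventually) (use g(1) in \<open>simp add: diff_eq_eq add.commute\<close>)
  have S_lim: "(\<lambda>k. (S ^^ N k) (g k)) \<longlonglongrightarrow> 0"
    using g(2) by (intro tendsto_zero_power2[OF _ null']) (metis le_add_same_cancel2 zero_le_power2)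
  \<comment> \<open>The vectors that witness transitivity: \<open>u k\<close> is near
    \<open>x\<close> and is sent near 0, while the small correction \<open>S\<^sup>N (g k)\<close>
    is sent near \<open>y\<close>.\<close>
  have "(\<lambda>k. u k + (S ^^ N k) (g k)) \<longlonglongrightarrow> x + 0"
    by (intro tendsto_add u_lim S_lim)
  moreover have "(\<lambda>k. (T ^^ N k) (u k + (S ^^ N k) (g k))) \<longlonglongrightarrow> 0 + y"
    using tendsto_add[OF Tu_lim TS_lim] by (simp add: linear_simps(1)[OF Tn])
  ultimately have "eventually (\<lambda>k. dist (u k + (S ^^ N k) (g k)) x < e \<and>
      dist ((T ^^ N k) (u k + (S ^^ N k) (g k))) y < e) sequentially"
    using e by (intro eventually_conj) (auto dest: tendstoD)
  then show "\<exists>v n. dist v x < e \<and> dist ((T ^^ n) v) y < e"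
    by (auto simp: eventually_sequentially)
qed

section \<open>The Hardy space as a Hilbert space\<close>

lemma h2_coeff_minus: "h2_coeff (f - g) n = h2_coeff f n - h2_coeff g n"
  by (simp add: minus_hardy2_def uminus_hardy2_def h2_coeff_plus h2_coeff_cscale)

lemma h2_coeff_sum: "h2_coeff (sum f I) n = (\<Sum>i\<in>I. h2_coeff (f i) n)"
  by (induction I rule: infinite_finite_induct) (auto simp: h2_coeff_zero h2_coeff_plus)

lemma h2_norm_power2: "(norm f)\<^sup>2 = (\<Sum>n. (norm (h2_coeff f n))\<^sup>2)"
  by (simp add: norm_hardy2_def suminf_nonneg[OF h2_coeff_summable])

lemma h2_norm_power2_sums: "(\<lambda>n. (norm (h2_coeff f n))\<^sup>2) sums (norm f)\<^sup>2"
  unfolding h2_norm_power2 by (rule summable_sums[OF h2_coeff_summable])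

lemma h2_partial_sum_le_norm: "finite I \<Longrightarrow> (\<Sum>n\<in>I. (norm (h2_coeff f n))\<^sup>2) \<le> (norm f)\<^sup>2"
  unfolding h2_norm_power2 by (rule sum_le_suminf[OF h2_coeff_summable]) auto

lemma h2_coeff_le_norm: "norm (h2_coeff f n) \<le> norm f"
  using h2_partial_sum_le_norm[of "{n}" f] by (auto intro: power2_le_imp_le)

lemma h2_cinner_sums: "(\<lambda>n. h2_coeff f n * cnj (h2_coeff g n)) sums h2_cinner f g"
  unfolding h2_cinner_def by (intro summable_sums square_summable_mult h2_coeff_summable)

lemma taylor_series_sums:
  assumes "f holomorphic_on unit_disc" "z \<in> unit_disc"
  shows "(\<lambda>n. taylor_coeff f n * z ^ n) sums f z"
  using holomorphic_power_series[OF assms] by (simp add: taylor_coeff_def)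

lemma h2_fun_sums: "z \<in> unit_disc \<Longrightarrow> (\<lambda>n. h2_coeff f n * z ^ n) sums h2_fun f z"
  unfolding h2_coeff_def by (rule taylor_series_sums[OF h2_fun_holomorphic])

text \<open>Reads off the Taylor coefficients of a function given by an explicit series, from the
  uniqueness of its expansion as a formal power series at 0.\<close>

lemma power_series_taylor:
  assumes "\<And>z. z \<in> unit_disc \<Longrightarrow> (\<lambda>n. a n * z ^ n) sums f z"
  shows "f holomorphic_on unit_disc" "taylor_coeff f = a"
proof -
  show hol: "f holomorphic_on unit_disc"
    using assms by (intro power_series_holomorphic[of 0 1 a]) auto
  have "eventually (\<lambda>z. z \<in> unit_disc) (nhds (0::complex))"
    by (intro eventually_nhds_in_open) auto
  then have "eventually (\<lambda>z. (\<lambda>n. fps_nth (Abs_fps a) n * z ^ n) sums f z) (nhds 0)"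
    by eventually_elim (simp add: assms)
  from fps_nth_fps_expansion[OF has_fps_expansionI[OF this]]
  show "taylor_coeff f = a" by (simp add: taylor_coeff_def fun_eq_iff)
qed

lemma h2_coeff_h2_of:
  assumes "f holomorphic_on unit_disc" "summable (\<lambda>n. (norm (taylor_coeff f n))\<^sup>2)"
  shows "h2_coeff (h2_of f) = taylor_coeff f"
proof -
  have "taylor_coeff (h2_fun (h2_of f)) = taylor_coeff f"
    using taylor_series_sums[OF assms(1)]
    by (intro power_series_taylor(2)) (simp add: h2_fun_h2_of[OF assms])
  then show ?thesis by (simp add: h2_coeff_def)
qed

definition h2_series :: "(nat \<Rightarrow> complex) \<Rightarrow> hardy2" where
  "h2_series a = h2_of (\<lambda>z. \<Sum>n. a n * z ^ n)"

text \<open>Square-summable coefficients are bounded, so a geometric series dominates the power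
  series on the disc. Together with \<open>h2_coeff_inject\<close> this identifies the Hardy space
  with the sequence space of square-summable sequences, where completeness, density and the Riesz
  theorem are proved.\<close>

lemma h2_coeff_h2_series:
  assumes "summable (\<lambda>n. (norm (a n))\<^sup>2)"
  shows "h2_coeff (h2_series a) = a"
proof -
  have "(\<lambda>n. (norm (a n))\<^sup>2) \<longlonglongrightarrow> 0" by (rule summable_LIMSEQ_zero[OF assms])
  then have "(\<lambda>n. sqrt ((norm (a n))\<^sup>2)) \<longlonglongrightarrow> sqrt 0" by (intro tendsto_intros)
  then have "(\<lambda>n. norm (a n)) \<longlonglongrightarrow> 0" by simp
  from convergent_imp_Bseq[OF convergentI[OF this]]
  obtain B where B: "\<And>n. norm (a n) \<le> B" by (auto simp: Bseq_def)
  have sums: "(\<lambda>n. a n * z ^ n) sums (\<Sum>n. a n * z ^ n)" if "z \<in> unit_disc" for z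
  proof (rule summable_sums, rule summable_comparison_test')
    show "summable (\<lambda>n. B * norm z ^ n)"
      using that by (intro summable_mult summable_geometric) auto
    show "norm (a n * z ^ n) \<le> B * norm z ^ n" for n
      by (simp add: norm_mult norm_power mult_right_mono B)
  qed
  note P = power_series_taylor[OF sums]
  show ?thesis
    unfolding h2_series_def using h2_coeff_h2_of[OF P(1)] P(2) assms by simp
qed

lemma h2_coeff_h2_series_finite:
  "h2_coeff (h2_series (\<lambda>n. if n < N then a n else 0)) n = (if n < N then a n else 0)"
  by (subst h2_coeff_h2_series, intro summable_finite[of "{..<N}"]) auto

lemma h2_norm_cscale: "norm (h2_cscale c f) = norm c * norm f"
proof -
  have "(norm (h2_cscale c f))\<^sup>2 = (norm c)\<^sup>2 * (\<Sum>n. (norm (h2_coeff f n))\<^sup>2)"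
    unfolding h2_norm_power2 h2_coeff_cscale norm_mult power_mult_distrib
    by (rule suminf_mult[OF h2_coeff_summable])
  also have "\<dots> = (norm c * norm f)\<^sup>2" by (simp add: h2_norm_power2 power_mult_distrib)
  finally show ?thesis by (simp add: power2_eq_iff_nonneg)
qed

text \<open>Multiplying \<open>f\<close> by a unimodular constant makes the complex inner product
  real and nonnegative without changing the norm of \<open>f\<close>. The Cauchy-Schwarz inequality
  of the real inner product then applies.\<close>

lemma h2_cinner_bound: "norm (h2_cinner f g) \<le> norm f * norm g"
proof (cases "h2_cinner f g = 0")
  case False
  let ?u = "cnj (sgn (h2_cinner f g))"
  have "?u * h2_cinner f g = of_real (norm (h2_cinner f g))"
    using False complex_norm_square[of "h2_cinner f g"]
    by (simp add: sgn_div_norm scaleR_conv_of_real power2_eq_square field_simps)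
  then have "inner (h2_cscale ?u f) g = norm (h2_cinner f g)"
    by (simp add: inner_hardy2_def h2_cinner_cscale_left)
  moreover have "norm (h2_cscale ?u f) = norm f"
    using False by (simp add: h2_norm_cscale norm_sgn)
  ultimately show ?thesis
    using norm_cauchy_schwarz[of "h2_cscale ?u f" g] by simp
qed simp

lemma h2_norm_le_if_partial_sums:
  assumes "\<And>N. (\<Sum>n<N. (norm (h2_coeff f n))\<^sup>2) \<le> c\<^sup>2" "c \<ge> 0"
  shows "norm f \<le> c"
proof -
  have "(norm f)\<^sup>2 \<le> c\<^sup>2"
    unfolding h2_norm_power2 by (intro suminf_le_const h2_coeff_summable assms)
  then show ?thesis using assms(2) by (rule power2_le_imp_le)
qed

instance hardy2 :: complete_space
proof
  fix X :: "nat \<Rightarrow> hardy2"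
  assume X: "Cauchy X"
  have "Cauchy (\<lambda>k. h2_coeff (X k) n)" for n
  proof (rule metric_CauchyI)
    fix e :: real assume "e > 0"
    then obtain M where M: "\<And>m k. m \<ge> M \<Longrightarrow> k \<ge> M \<Longrightarrow> dist (X m) (X k) < e"
      using metric_CauchyD[OF X] by blast
    have "dist (h2_coeff (X m) n) (h2_coeff (X k) n) < e" if "m \<ge> M" "k \<ge> M" for m k
      using M[OF that] h2_coeff_le_norm[of "X m - X k" n] by (simp add: dist_norm h2_coeff_minus)
    then show "\<exists>M. \<forall>m\<ge>M. \<forall>k\<ge>M. dist (h2_coeff (X m) n) (h2_coeff (X k) n) < e" by blast
  qed
  then have "\<exists>l. (\<lambda>k. h2_coeff (X k) n) \<longlonglongrightarrow> l" for n
    using Cauchy_convergent convergent_def by blast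
  then obtain a where a: "\<And>n. (\<lambda>k. h2_coeff (X k) n) \<longlonglongrightarrow> a n" by metis
  \<comment> \<open>Only finite sums are estimated here: in them the limit in \<open>m\<close> can
    be taken termwise, before \<open>a\<close> is known to be square-summable.\<close>
  have tail: "\<exists>M. \<forall>k\<ge>M. \<forall>N. (\<Sum>n<N. (norm (a n - h2_coeff (X k) n))\<^sup>2) \<le> e\<^sup>2" if "e > 0" for e
  proof -
    from that obtain M where M: "\<And>m k. m \<ge> M \<Longrightarrow> k \<ge> M \<Longrightarrow> dist (X m) (X k) < e"
      using metric_CauchyD[OF X] by blast
    have "(\<Sum>n<N. (norm (a n - h2_coeff (X k) n))\<^sup>2) \<le> e\<^sup>2" if "k \<ge> M" for k N
    proof (rule LIMSEQ_le_const2)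
      show "(\<lambda>m. \<Sum>n<N. (norm (h2_coeff (X m) n - h2_coeff (X k) n))\<^sup>2)
          \<longlonglongrightarrow> (\<Sum>n<N. (norm (a n - h2_coeff (X k) n))\<^sup>2)"
        by (intro tendsto_intros a)
      have "(\<Sum>n<N. (norm (h2_coeff (X m) n - h2_coeff (X k) n))\<^sup>2) \<le> e\<^sup>2" if m: "m \<ge> M" for m
      proof -
        have "(\<Sum>n<N. (norm (h2_coeff (X m) n - h2_coeff (X k) n))\<^sup>2) \<le> (norm (X m - X k))\<^sup>2"
          using h2_partial_sum_le_norm[of "{..<N}" "X m - X k"] by (simp add: h2_coeff_minus)
        also have "\<dots> \<le> e\<^sup>2"
          using M[OF m \<open>k \<ge> M\<close>] by (intro power_mono) (auto simp: dist_norm)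
        finally show ?thesis .
      qed
      then show "\<exists>M. \<forall>m\<ge>M. (\<Sum>n<N. (norm (h2_coeff (X m) n - h2_coeff (X k) n))\<^sup>2) \<le> e\<^sup>2"
        by blast
    qed
    then show ?thesis by blast
  qed
  \<comment> \<open>\<open>a\<close> differs from the coefficients of the single vector
    \<open>X M\<close> by a square-summable sequence, so it is square-summable itself.\<close>
  obtain M where M: "\<And>N. (\<Sum>n<N. (norm (a n - h2_coeff (X M) n))\<^sup>2) \<le> 1\<^sup>2"
    using tail[of 1] by auto
  have "summable (\<lambda>n. (norm (a n - h2_coeff (X M) n))\<^sup>2)"
    using M by (intro summableI_nonneg_bounded) auto
  from square_summable_add[OF this h2_coeff_summable[of "X M"]]
  have "summable (\<lambda>n. (norm (a n))\<^sup>2)" by simp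
  then have f: "h2_coeff (h2_series a) = a" by (rule h2_coeff_h2_series)
  have "X \<longlonglongrightarrow> h2_series a"
  proof (rule metric_LIMSEQ_I)
    fix e :: real assume "e > 0"
    then obtain M where M: "\<And>k N. k \<ge> M \<Longrightarrow> (\<Sum>n<N. (norm (a n - h2_coeff (X k) n))\<^sup>2) \<le> (e / 2)\<^sup>2"
      using tail[of "e / 2"] by auto
    have "dist (X k) (h2_series a) < e" if "k \<ge> M" for k
    proof -
      have "norm (h2_series a - X k) \<le> e / 2"
        using M[OF that] \<open>e > 0\<close> by (intro h2_norm_le_if_partial_sums) (auto simp: h2_coeff_minus f)
      then show ?thesis using \<open>e > 0\<close> by (simp add: dist_norm norm_minus_commute)
    qed
    then show "\<exists>M. \<forall>k\<ge>M. dist (X k) (h2_series a) < e" by blast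
  qed
  then show "convergent X" by (rule convergentI)
qed

section \<open>Truncations and separability\<close>

definition h2_truncate :: "nat \<Rightarrow> hardy2 \<Rightarrow> hardy2" where
  "h2_truncate N f = h2_series (\<lambda>n. if n < N then h2_coeff f n else 0)"

lemma h2_coeff_truncate: "h2_coeff (h2_truncate N f) n = (if n < N then h2_coeff f n else 0)"
  unfolding h2_truncate_def by (rule h2_coeff_h2_series_finite)

lemma h2_truncate_tendsto: "(\<lambda>N. h2_truncate N f) \<longlonglongrightarrow> f"
proof -
  have sq: "(norm (f - h2_truncate N f))\<^sup>2 = (norm f)\<^sup>2 - (\<Sum>n<N. (norm (h2_coeff f n))\<^sup>2)" for N
  proof -
    have "(\<lambda>n. (norm (h2_coeff f n))\<^sup>2 - (if n \<in> {..<N} then (norm (h2_coeff f n))\<^sup>2 else 0)) sums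
        ((norm f)\<^sup>2 - (\<Sum>n<N. (norm (h2_coeff f n))\<^sup>2))"
      by (intro sums_diff h2_norm_power2_sums sums_If_finite_set) auto
    moreover have "(norm (h2_coeff f n))\<^sup>2 - (if n \<in> {..<N} then (norm (h2_coeff f n))\<^sup>2 else 0)
        = (norm (h2_coeff (f - h2_truncate N f) n))\<^sup>2" for n
      by (simp add: h2_coeff_minus h2_coeff_truncate)
    ultimately show ?thesis
      using sums_unique2[OF h2_norm_power2_sums[of "f - h2_truncate N f"]] by simp
  qed
  have "(\<lambda>N. (norm f)\<^sup>2 - (\<Sum>n<N. (norm (h2_coeff f n))\<^sup>2)) \<longlonglongrightarrow> (norm f)\<^sup>2 - (norm f)\<^sup>2"
    using h2_norm_power2_sums[of f] unfolding sums_def by (intro tendsto_intros)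
  then have lim: "(\<lambda>N. (norm f)\<^sup>2 - (\<Sum>n<N. (norm (h2_coeff f n))\<^sup>2)) \<longlonglongrightarrow> 0"
    by simp
  have "(\<lambda>N. f - h2_truncate N f) \<longlonglongrightarrow> 0"
    by (rule tendsto_zero_power2[OF _ lim]) (simp add: sq)
  then show ?thesis
    using tendsto_diff[OF tendsto_const[of f]] by fastforce
qed

lemma h2_countable_dense: "\<exists>D :: hardy2 set. countable D \<and> closure D = UNIV"
proof -
  \<comment> \<open>Polynomials with Gaussian rational coefficients, coded by lists of pairs of
    rationals. The codes form a countable type, so the range of \<open>p\<close> is
    countable.\<close>
  define p where "p xs = h2_series (\<lambda>n. if n < length xs then
    Complex (real_of_rat (fst (xs ! n))) (real_of_rat (snd (xs ! n))) else 0)" for xs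
  have "\<exists>d\<in>range p. dist d f < e" if e: "e > 0" for f e
  proof -
    obtain N where N: "dist (h2_truncate N f) f < e / 2"
      using metric_LIMSEQ_D[OF h2_truncate_tendsto, of "e / 2" f] e by auto
    \<comment> \<open>Each of the \<open>N\<close> coefficients is matched up to
      \<open>2 * d\<close>, and \<open>N * (2 * d) < e / 2\<close>. The summand 1 keeps the
      denominator positive when \<open>N = 0\<close>.\<close>
    define d where "d = e / (4 * (real N + 1))"
    have d: "d > 0" using e by (simp add: d_def)
    have "\<exists>q. \<bar>real_of_rat q - x\<bar> < d" for x
    proof -
      obtain r where "x - d < real_of_rat r" "real_of_rat r < x + d"
        using of_rat_dense[of "x - d" "x + d"] d by auto
      then show ?thesis by (intro exI[of _ r]) linarith
    qed
    then obtain q where q: "\<And>x. \<bar>real_of_rat (q x) - x\<bar> < d" by metis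
    define xs where "xs = map (\<lambda>n. (q (Re (h2_coeff f n)), q (Im (h2_coeff f n)))) [0..<N]"
    have coeff: "norm (h2_coeff (p xs - h2_truncate N f) n) \<le> 2 * d" if "n < N" for n
    proof -
      have "h2_coeff (p xs - h2_truncate N f) n = Complex (real_of_rat (q (Re (h2_coeff f n))) - Re (h2_coeff f n))
          (real_of_rat (q (Im (h2_coeff f n))) - Im (h2_coeff f n))"
        using that unfolding h2_coeff_minus h2_coeff_truncate p_def h2_coeff_h2_series_finite
        by (simp add: xs_def complex_eq_iff)
      moreover have "norm (Complex (real_of_rat (q (Re (h2_coeff f n))) - Re (h2_coeff f n))
          (real_of_rat (q (Im (h2_coeff f n))) - Im (h2_coeff f n))) \<le> d + d"
        using cmod_le[of "Complex (real_of_rat (q (Re (h2_coeff f n))) - Re (h2_coeff f n))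
          (real_of_rat (q (Im (h2_coeff f n))) - Im (h2_coeff f n))"]
          q[of "Re (h2_coeff f n)"] q[of "Im (h2_coeff f n)"] by simp
      ultimately show ?thesis by simp
    qed
    have "norm (p xs - h2_truncate N f) \<le> real N * (2 * d)"
    proof (rule h2_norm_le_if_partial_sums)
      fix K
      have zero: "h2_coeff (p xs - h2_truncate N f) n = 0" if "n \<ge> N" for n
        using that unfolding h2_coeff_minus h2_coeff_truncate p_def h2_coeff_h2_series_finite
        by (simp add: xs_def)
      have "(\<Sum>n<K. (norm (h2_coeff (p xs - h2_truncate N f) n))\<^sup>2)
          = (\<Sum>n\<in>{..<K} \<inter> {..<N}. (norm (h2_coeff (p xs - h2_truncate N f) n))\<^sup>2)"
        by (rule sum.mono_neutral_right) (auto simp: zero not_less[symmetric])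
      also have "\<dots> \<le> (\<Sum>n<N. (norm (h2_coeff (p xs - h2_truncate N f) n))\<^sup>2)"
        by (rule sum_mono2) auto
      also have "\<dots> \<le> (\<Sum>n<N. (2 * d)\<^sup>2)"
        using coeff by (intro sum_mono power_mono) auto
      also have "\<dots> = real N * (2 * d)\<^sup>2" by simp
      also have "\<dots> \<le> (real N)\<^sup>2 * (2 * d)\<^sup>2"
        by (intro mult_right_mono) (auto simp flip: of_nat_power simp: power2_nat_le_imp_le self_le_power)
      finally show "(\<Sum>n<K. (norm (h2_coeff (p xs - h2_truncate N f) n))\<^sup>2) \<le> (real N * (2 * d))\<^sup>2"
        by (simp add: power_mult_distrib)
    qed (use d in auto)
    also have "\<dots> < e / 2" using e by (simp add: d_def field_simps)
    finally have "dist (p xs) f < e"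
      using N dist_triangle[of "p xs" f "h2_truncate N f"] by (simp add: dist_norm)
    then show ?thesis by blast
  qed
  then have "closure (range p) = UNIV" by (auto simp: closure_approachable)
  moreover have "countable (range p)" by simp
  ultimately show ?thesis by blast
qed

section \<open>Monomials, the Riesz representation and adjoints\<close>

definition h2_monomial :: "nat \<Rightarrow> hardy2" where
  "h2_monomial n = h2_series (\<lambda>m. if m = n then 1 else 0)"

lemma h2_coeff_monomial: "h2_coeff (h2_monomial n) m = (if m = n then 1 else 0)"
  unfolding h2_monomial_def by (subst h2_coeff_h2_series, intro summable_finite[of "{n}"]) auto

lemma h2_cinner_monomial_left: "h2_cinner (h2_monomial n) g = cnj (h2_coeff g n)"
proof -
  have "(\<lambda>m. if m = n then cnj (h2_coeff g m) else 0) sums cnj (h2_coeff g n)"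
    by (rule sums_single)
  moreover have "(\<lambda>m. h2_coeff (h2_monomial n) m * cnj (h2_coeff g m)) =
      (\<lambda>m. if m = n then cnj (h2_coeff g m) else 0)"
    by (auto simp: h2_coeff_monomial)
  ultimately show ?thesis
    using h2_cinner_sums[of "h2_monomial n" g] by (metis sums_unique2)
qed

lemma h2_cinner_cscale_right: "h2_cinner f (h2_cscale c g) = cnj c * h2_cinner f g"
  unfolding h2_cinner_commute[of f "h2_cscale c g"] h2_cinner_cscale_left h2_cinner_commute[of f g]
  by simp

lemma h2_cinner_plus_right: "h2_cinner f (g + h) = h2_cinner f g + h2_cinner f h"
  unfolding h2_cinner_commute[of f "g + h"] h2_cinner_plus_left h2_cinner_commute[of f g]
    h2_cinner_commute[of f h]
  by simp

lemma h2_cinner_self_norm: "h2_cinner f f = of_real ((norm f)\<^sup>2)"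
  by (simp only: h2_cinner_self h2_norm_power2)

lemma h2_eq_if_cinner_eq:
  assumes "\<And>f. h2_cinner f g = h2_cinner f h"
  shows "g = h"
proof (rule h2_coeff_inject)
  show "h2_coeff g n = h2_coeff h n" for n
    using assms[of "h2_monomial n"] by (simp add: h2_cinner_monomial_left)
qed

lemma h2_truncate_eq_sum: "h2_truncate N f = (\<Sum>n<N. h2_cscale (h2_coeff f n) (h2_monomial n))"
proof (rule h2_coeff_inject)
  fix m
  have "h2_coeff f n * (if m = n then 1 else 0) = (if n = m then h2_coeff f n else 0)" for n
    by simp
  then show "h2_coeff (h2_truncate N f) m =
      h2_coeff (\<Sum>n<N. h2_cscale (h2_coeff f n) (h2_monomial n)) m"
    by (simp add: h2_coeff_truncate h2_coeff_sum h2_coeff_cscale h2_coeff_monomial)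
qed

text \<open>The monomials force the coefficients \<open>a n\<close> of the representing vector. To
  see that these are square-summable, test \<open>L\<close> on the vector \<open>p\<close> with
  coefficients \<open>a n\<close> for \<open>n < N\<close>: there \<open>L p\<close> equals the
  squared norm of \<open>p\<close>, so the bound on \<open>L\<close> gives
  \<open>norm p \<le> M\<close> unless \<open>p = 0\<close>. The two functionals agree on
  truncations, and both sides pass to the limit.\<close>

lemma h2_riesz_representation:
  fixes L :: "hardy2 \<Rightarrow> complex"
  assumes add: "\<And>f g. L (f + g) = L f + L g"
    and scale: "\<And>c f. L (h2_cscale c f) = c * L f"
    and bound: "\<And>f. norm (L f) \<le> M * norm f"
  shows "\<exists>h. \<forall>f. L f = h2_cinner f h"
proof -
  have L0: "L 0 = 0" using add[of 0 0] by simp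
  have Lsum: "L (sum F I) = (\<Sum>i\<in>I. L (F i))" for F and I :: "nat set"
    by (induction I rule: infinite_finite_induct) (auto simp: L0 add)
  define a where "a n = cnj (L (h2_monomial n))" for n
  have Ltrunc: "L (h2_truncate N f) = (\<Sum>n<N. h2_coeff f n * cnj (a n))" for N f
    by (simp add: h2_truncate_eq_sum Lsum scale a_def)
  have partial: "(\<Sum>n<N. (norm (a n))\<^sup>2) \<le> M\<^sup>2" for N
  proof -
    define p where "p = h2_series (\<lambda>n. if n < N then a n else 0)"
    have p: "h2_coeff p n = (if n < N then a n else 0)" for n
      unfolding p_def by (rule h2_coeff_h2_series_finite)
    define s where "s = (\<Sum>n<N. (norm (a n))\<^sup>2)"
    have s: "s \<ge> 0" by (simp add: s_def sum_nonneg)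
    have "h2_truncate N p = p"
      by (rule h2_coeff_inject) (simp add: h2_coeff_truncate p)
    then have "L p = (\<Sum>n<N. h2_coeff p n * cnj (a n))" by (metis Ltrunc)
    also have "\<dots> = of_real s"
      unfolding s_def of_real_sum by (rule sum.cong) (simp_all add: p flip: complex_norm_square)
    finally have Lp: "norm (L p) = s" using s by simp
    have "(\<lambda>n. (norm (h2_coeff p n))\<^sup>2) sums s"
      using sums_If_finite_set[of "{..<N}" "\<lambda>n. (norm (a n))\<^sup>2"]
      by (simp add: p s_def if_distrib[of "\<lambda>x. (norm x)\<^sup>2"] cong: if_cong)
    then have "(norm p)\<^sup>2 = s" using h2_norm_power2_sums sums_unique2 by blast
    then have "norm p * norm p \<le> M * norm p"
      using bound[of p] Lp by (simp add: power2_eq_square)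
    then have "norm p \<le> M \<or> norm p = 0" by (auto simp: mult_le_cancel_right)
    then have "(norm p)\<^sup>2 \<le> M\<^sup>2" by (auto intro: power_mono)
    then show ?thesis using \<open>(norm p)\<^sup>2 = s\<close> by (simp add: s_def)
  qed
  have "summable (\<lambda>n. (norm (a n))\<^sup>2)"
    using partial by (intro summableI_nonneg_bounded) auto
  then have h: "h2_coeff (h2_series a) = a" by (rule h2_coeff_h2_series)
  have "L f = h2_cinner f (h2_series a)" for f
  proof (rule LIMSEQ_unique)
    show "(\<lambda>N. L (h2_truncate N f)) \<longlonglongrightarrow> h2_cinner f (h2_series a)"
      using h2_cinner_sums[of f "h2_series a"] by (simp add: Ltrunc h sums_def)
    have "(\<lambda>N. norm (h2_truncate N f - f)) \<longlonglongrightarrow> 0"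
      using h2_truncate_tendsto[of f] by (simp add: LIM_zero tendsto_norm_zero)
    then have "(\<lambda>N. M * norm (h2_truncate N f - f)) \<longlonglongrightarrow> 0"
      by (rule tendsto_mult_right_zero)
    then have "(\<lambda>N. L (h2_truncate N f) - L f) \<longlonglongrightarrow> 0"
    proof (rule Lim_null_comparison[rotated], intro always_eventually allI)
      show "norm (L (h2_truncate N f) - L f) \<le> M * norm (h2_truncate N f - f)" for N
        using bound[of "h2_truncate N f - f"] add[of "h2_truncate N f - f" f] by simp
    qed
    then show "(\<lambda>N. L (h2_truncate N f)) \<longlonglongrightarrow> L f" by (rule LIM_zero_cancel)
  qed
  then show ?thesis by blast
qed

lemma bounded_operatorI:
  assumes "\<And>f g. A (f + g) = A f + A g" "\<And>c f. A (h2_cscale c f) = h2_cscale c (A f)"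
    and "\<And>f. norm (A f) \<le> M * norm f"
  shows "bounded_operator A"
  unfolding bounded_operator_def
  using assms by (auto intro!: bounded_linear_intro[of _ M] simp: scaleR_hardy2_def mult.commute)

text \<open>The definite description in \<open>h2_adjoint\<close> is meaningful: existence comes
  from the Riesz representation, and uniqueness from testing against monomials. The bound on the
  norm follows by evaluating the adjoint relation at \<open>h2_adjoint A g\<close> itself.\<close>

lemma h2_adjoint:
  assumes A: "bounded_operator A"
  shows "h2_cinner (A f) g = h2_cinner f (h2_adjoint A g)"
    and "bounded_operator (h2_adjoint A)"
proof -
  interpret A: bounded_linear A using A by (simp add: bounded_operator_def)
  have scale: "A (h2_cscale c f) = h2_cscale c (A f)" for c f
    using A by (simp add: bounded_operator_def)
  obtain M where M: "M > 0" "\<And>f. norm (A f) \<le> norm f * M"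
    using A.pos_bounded by blast
  have adj: "h2_cinner (A f) g = h2_cinner f (h2_adjoint A g)" for f g
  proof -
    have "\<exists>h. \<forall>f. h2_cinner (A f) g = h2_cinner f h"
    proof (rule h2_riesz_representation)
      show "norm (h2_cinner (A f) g) \<le> (M * norm g) * norm f" for f
        using h2_cinner_bound[of "A f" g] mult_right_mono[OF M(2)[of f] norm_ge_zero[of g]]
        by (simp add: mult_ac)
    qed (simp_all add: A.add scale h2_cinner_plus_left h2_cinner_cscale_left)
    then obtain h where h: "\<forall>f. h2_cinner (A f) g = h2_cinner f h" by blast
    have "\<forall>f. h2_cinner (A f) g = h2_cinner f (h2_adjoint A g)"
      unfolding h2_adjoint_def
      by (rule theI[of _ h]) (use h in \<open>auto intro!: h2_eq_if_cinner_eq\<close>)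
    then show ?thesis by blast
  qed
  show "h2_cinner (A f) g = h2_cinner f (h2_adjoint A g)" by (rule adj)
  show "bounded_operator (h2_adjoint A)"
  proof (rule bounded_operatorI)
    show "h2_adjoint A (f + g) = h2_adjoint A f + h2_adjoint A g" for f g
      by (rule h2_eq_if_cinner_eq) (simp add: adj[symmetric] h2_cinner_plus_right)
    show "h2_adjoint A (h2_cscale c f) = h2_cscale c (h2_adjoint A f)" for c f
      by (rule h2_eq_if_cinner_eq) (simp add: adj[symmetric] h2_cinner_cscale_right)
    show "norm (h2_adjoint A g) \<le> M * norm g" for g
    proof -
      have "of_real ((norm (h2_adjoint A g))\<^sup>2) = h2_cinner (A (h2_adjoint A g)) g"
        by (simp add: adj h2_cinner_self_norm)
      then have "(norm (h2_adjoint A g))\<^sup>2 = norm (h2_cinner (A (h2_adjoint A g)) g)"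
        by (metis norm_of_real abs_power2)
      also have "\<dots> \<le> norm (h2_adjoint A g) * M * norm g"
        using h2_cinner_bound[of "A (h2_adjoint A g)" g]
          mult_right_mono[OF M(2)[of "h2_adjoint A g"] norm_ge_zero[of g]] by linarith
      finally have "norm (h2_adjoint A g) * norm (h2_adjoint A g) \<le> norm (h2_adjoint A g) * (M * norm g)"
        by (simp add: power2_eq_square mult_ac)
      then show ?thesis
        using M(1) by (cases "h2_adjoint A g = 0") (auto simp: mult_le_cancel_left)
    qed
  qed
qed

section \<open>Multiplication and rotation operators\<close>

text \<open>A finite counterpart of integrating over the circle. After expanding the squares, the
  sum over \<open>j\<close> is a geometric sum whose ratio \<open>w ^ n * cnj w ^ m\<close> is an
  \<open>N\<close>-th root of unity, different from 1 for \<open>n \<noteq> m\<close>; so only the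
  diagonal terms survive.\<close>

lemma parseval_roots_of_unity:
  fixes c :: "nat \<Rightarrow> complex"
  assumes N: "N > 0"
  shows "(\<Sum>j<N. (norm (\<Sum>n<N. c n * (cis (2 * pi / real N) ^ j) ^ n))\<^sup>2) = real N * (\<Sum>n<N. (norm (c n))\<^sup>2)"
proof -
  define w where "w = cis (2 * pi / real N)"
  have wN: "w ^ N = 1" using N by (simp add: w_def Complex.DeMoivre)
  have cw: "w * cnj w = 1" by (simp add: w_def cis_cnj cis_mult)
  have inj: "n = m" if "w ^ n = w ^ m" "n < N" "m < N" for n m
  proof -
    have "inj_on (\<lambda>k. cis (2 * pi * real k / real N)) {..<N}"
      using Complex.bij_betw_roots_unity[OF N] by (simp add: bij_betw_def)
    then show ?thesis
      using that by (auto simp: inj_on_def w_def Complex.DeMoivre mult_ac)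
  qed
  have orth: "(\<Sum>j<N. (w ^ n * cnj w ^ m) ^ j) = (if n = m then of_nat N else 0)"
    if "n < N" "m < N" for n m
  proof (cases "n = m")
    case True
    then show ?thesis by (simp add: power_mult_distrib[symmetric] cw)
  next
    case False
    have "w ^ n * cnj w ^ m \<noteq> 1"
    proof
      assume "w ^ n * cnj w ^ m = 1"
      then have "w ^ n * (w * cnj w) ^ m = w ^ m"
        by (simp add: power_mult_distrib mult_ac)
      then show False using inj[of n m] that False by (simp add: cw)
    qed
    moreover have "(w ^ n * cnj w ^ m) ^ N = (w ^ N) ^ n * cnj (w ^ N) ^ m"
      by (simp add: power_mult_distrib mult.commute flip: power_mult)
    ultimately show ?thesis
      using False by (simp add: geometric_sum wN)
  qed
  have "(\<Sum>j<N. of_real ((norm (\<Sum>n<N. c n * (w ^ j) ^ n))\<^sup>2)) =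
      (\<Sum>j<N. \<Sum>n<N. \<Sum>m<N. c n * cnj (c m) * (w ^ n * cnj w ^ m) ^ j)"
    unfolding complex_norm_square cnj_sum sum_product
    by (intro sum.cong refl) (simp add: power_mult_distrib mult_ac flip: power_mult)
  also have "\<dots> = (\<Sum>n<N. \<Sum>j<N. \<Sum>m<N. c n * cnj (c m) * (w ^ n * cnj w ^ m) ^ j)"
    by (rule sum.swap)
  also have "\<dots> = (\<Sum>n<N. \<Sum>m<N. c n * cnj (c m) * (\<Sum>j<N. (w ^ n * cnj w ^ m) ^ j))"
    unfolding sum_distrib_left by (rule sum.cong[OF refl], rule sum.swap)
  also have "\<dots> = (\<Sum>n<N. \<Sum>m<N. if m = n then of_nat N * (c n * cnj (c n)) else 0)"
    by (intro sum.cong refl) (auto simp: orth)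
  also have "\<dots> = of_nat N * (\<Sum>n<N. of_real ((norm (c n))\<^sup>2))"
    unfolding complex_norm_square by (simp add: sum_distrib_left)
  finally have "complex_of_real (\<Sum>j<N. (norm (\<Sum>n<N. c n * (w ^ j) ^ n))\<^sup>2)
      = complex_of_real (real N * (\<Sum>n<N. (norm (c n))\<^sup>2))"
    by (simp only: of_real_sum of_real_mult of_real_of_nat_eq)
  then show ?thesis by (simp only: of_real_eq_iff w_def)
qed

lemma summable_norm_power2:
  assumes sm: "summable (\<lambda>n. norm (a n))"
  shows "summable (\<lambda>n. (norm (a n))\<^sup>2)"
proof (rule summable_comparison_test')
  show "summable (\<lambda>n. (\<Sum>k. norm (a k)) * norm (a n))" by (rule summable_mult[OF sm])
  have "norm (a n) \<le> (\<Sum>k. norm (a k))" for n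
    using sum_le_suminf[OF sm, of "{n}"] by simp
  then show "norm ((norm (a n))\<^sup>2) \<le> (\<Sum>k. norm (a k)) * norm (a n)" for n
    by (simp add: power2_eq_square mult_right_mono)
qed

text \<open>If the series is cut off at \<open>N\<close>, the finite identity makes the
  \<open>N\<close>-point mean equal to the \<open>N\<close>-th partial sum. The cut changes each
  squared modulus by at most \<open>t N * (2 * S)\<close>, where \<open>t N\<close> is the tail of
  the absolutely convergent series: factor the difference of squares.\<close>

lemma circle_mean_tendsto:
  fixes a :: "nat \<Rightarrow> complex"
  assumes sm: "summable (\<lambda>n. norm (a n))"
  shows "(\<lambda>N. (\<Sum>j<N. (norm (\<Sum>n. a n * (cis (2 * pi / real N) ^ j) ^ n))\<^sup>2) / real N)
    \<longlonglongrightarrow> (\<Sum>n. (norm (a n))\<^sup>2)"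
proof -
  define S where "S = (\<Sum>n. norm (a n))"
  define t where "t N = S - (\<Sum>n<N. norm (a n))" for N
  have t0: "t \<longlonglongrightarrow> 0"
  proof -
    have "(\<lambda>N. S - (\<Sum>n<N. norm (a n))) \<longlonglongrightarrow> S - S"
      unfolding S_def by (intro tendsto_intros summable_LIMSEQ sm)
    then show ?thesis by (simp add: t_def[abs_def])
  qed
  have le_S: "(\<Sum>n<N. norm (a n)) \<le> S" for N
    unfolding S_def by (rule sum_le_suminf[OF sm]) auto
  have S0: "S \<ge> 0" using le_S[of 0] by simp
  note sq = summable_norm_power2[OF sm]
  have close: "\<bar>(norm (\<Sum>n. a n * u ^ n))\<^sup>2 - (norm (\<Sum>n<N. a n * u ^ n))\<^sup>2\<bar> \<le> t N * (2 * S)"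
    if "norm u = 1" for u N
  proof -
    define F where "F = (\<Sum>n. a n * u ^ n)"
    define P where "P = (\<Sum>n<N. a n * u ^ n)"
    have nm: "norm (a n * u ^ n) = norm (a n)" for n
      using that by (simp add: norm_mult norm_power)
    have sF: "summable (\<lambda>n. a n * u ^ n)"
      by (rule summable_norm_cancel) (simp only: nm sm)
    have "F - P = (\<Sum>n. a (n + N) * u ^ (n + N))"
      unfolding F_def P_def by (subst suminf_split_initial_segment[OF sF, of N]) simp
    also have "norm \<dots> \<le> (\<Sum>n. norm (a (n + N) * u ^ (n + N)))"
      using summable_ignore_initial_segment[OF sm, of N] by (intro summable_norm) (simp only: nm)
    also have "\<dots> = t N"
      unfolding t_def S_def nm by (subst suminf_split_initial_segment[OF sm, of N]) simp
    finally have FP: "norm (F - P) \<le> t N" .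
    have "norm F \<le> S"
      unfolding F_def S_def using summable_norm[of "\<lambda>n. a n * u ^ n"] by (simp only: nm sm simp_thms)
    moreover have "norm P \<le> S"
      unfolding P_def using norm_sum[of "\<lambda>n. a n * u ^ n" "{..<N}"] le_S[of N] by (simp only: nm)
    ultimately have sum: "norm F + norm P \<le> 2 * S" by linarith
    have "(norm F)\<^sup>2 - (norm P)\<^sup>2 = (norm F - norm P) * (norm F + norm P)"
      by (simp add: power2_eq_square algebra_simps)
    then have "\<bar>(norm F)\<^sup>2 - (norm P)\<^sup>2\<bar> = \<bar>norm F - norm P\<bar> * (norm F + norm P)"
      by (simp add: abs_mult)
    also have "\<dots> \<le> t N * (2 * S)"
      using FP norm_triangle_ineq3[of F P] sum by (intro mult_mono) auto
    finally show ?thesis by (simp add: F_def P_def)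
  qed
  define A where "A N = (\<Sum>j<N. (norm (\<Sum>n. a n * (cis (2 * pi / real N) ^ j) ^ n))\<^sup>2) / real N" for N
  have dist: "\<bar>A N - (\<Sum>n<N. (norm (a n))\<^sup>2)\<bar> \<le> t N * (2 * S)" if N: "N > 0" for N
  proof -
    define u where "u j = cis (2 * pi / real N) ^ j" for j
    have "(\<Sum>n<N. (norm (a n))\<^sup>2) = (\<Sum>j<N. (norm (\<Sum>n<N. a n * u j ^ n))\<^sup>2) / real N"
      using parseval_roots_of_unity[OF N, of a] N by (simp add: u_def)
    then have "A N - (\<Sum>n<N. (norm (a n))\<^sup>2) =
        (\<Sum>j<N. (norm (\<Sum>n. a n * u j ^ n))\<^sup>2 - (norm (\<Sum>n<N. a n * u j ^ n))\<^sup>2) / real N"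
      by (simp add: A_def u_def sum_subtractf diff_divide_distrib)
    also have "\<bar>\<dots>\<bar> \<le> (\<Sum>j<N. t N * (2 * S)) / real N"
      unfolding abs_divide abs_of_nat
      by (intro divide_right_mono order_trans[OF sum_abs] sum_mono close) (auto simp: u_def norm_power)
    also have "\<dots> = t N * (2 * S)" using N by simp
    finally show ?thesis .
  qed
  have "(\<lambda>N. t N * (2 * S)) \<longlonglongrightarrow> 0"
    using tendsto_mult[OF t0 tendsto_const[of "2 * S"]] by simp
  then have "(\<lambda>N. A N - (\<Sum>n<N. (norm (a n))\<^sup>2)) \<longlonglongrightarrow> 0"
    by (rule Lim_null_comparison[rotated]) (auto simp: eventually_sequentially dist intro!: exI[of _ 1])
  from tendsto_add[OF this summable_LIMSEQ[OF sq]]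
  show ?thesis by (simp add: A_def)
qed

text \<open>Domination at each point of the circle is inherited by the means over roots of unity,
  hence by their limits.\<close>

lemma suminf_power2_le_if_dominated:
  fixes a b :: "nat \<Rightarrow> complex"
  assumes a: "summable (\<lambda>n. norm (a n))" and b: "summable (\<lambda>n. norm (b n))"
    and le: "\<And>u. norm u = 1 \<Longrightarrow> norm (\<Sum>n. a n * u ^ n) \<le> M * norm (\<Sum>n. b n * u ^ n)"
  shows "(\<Sum>n. (norm (a n))\<^sup>2) \<le> M\<^sup>2 * (\<Sum>n. (norm (b n))\<^sup>2)"
proof (rule tendsto_le[OF sequentially_bot])
  show "eventually (\<lambda>N. (\<Sum>j<N. (norm (\<Sum>n. a n * (cis (2 * pi / real N) ^ j) ^ n))\<^sup>2) / real N
    \<le> M\<^sup>2 * ((\<Sum>j<N. (norm (\<Sum>n. b n * (cis (2 * pi / real N) ^ j) ^ n))\<^sup>2) / real N)) sequentially"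
  proof (intro always_eventually allI)
    fix N
    define u where "u j = cis (2 * pi / real N) ^ j" for j
    have "norm (u j) = 1" for j by (simp add: u_def norm_power)
    then have "(\<Sum>j<N. (norm (\<Sum>n. a n * u j ^ n))\<^sup>2) \<le> (\<Sum>j<N. M\<^sup>2 * (norm (\<Sum>n. b n * u j ^ n))\<^sup>2)"
      unfolding power_mult_distrib[symmetric] by (intro sum_mono power_mono le) auto
    then show "(\<Sum>j<N. (norm (\<Sum>n. a n * (cis (2 * pi / real N) ^ j) ^ n))\<^sup>2) / real N
      \<le> M\<^sup>2 * ((\<Sum>j<N. (norm (\<Sum>n. b n * (cis (2 * pi / real N) ^ j) ^ n))\<^sup>2) / real N)"
      unfolding u_def times_divide_eq_right sum_distrib_left by (rule divide_right_mono) simp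
  qed
qed (intro circle_mean_tendsto tendsto_mult tendsto_const a b)+

section \<open>Boundedness of multiplication and rotation\<close>

lemma taylor_series_abs_summable:
  assumes "f holomorphic_on unit_disc" "norm z < 1"
  shows "summable (\<lambda>n. norm (taylor_coeff f n * z ^ n))"
proof -
  obtain x where x: "norm z < x" "x < 1" using dense[OF assms(2)] by blast
  have "(of_real x :: complex) \<in> unit_disc" using x order_trans[OF norm_ge_zero[of z], of x] by simp
  from sums_summable[OF taylor_series_sums[OF assms(1) this]]
  show ?thesis by (rule powser_insidea) (use x in auto)
qed

text \<open>The pointwise bound on \<open>psi\<close> is available only inside the disc, so the
  comparison is made on circles of radius \<open>r < 1\<close>. There the coefficients, multiplied
  by \<open>r ^ n\<close>, are absolutely summable. Stating the result for partial sums yields both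
  the square-summability of the product and the operator bound \<open>M\<close>.\<close>

lemma product_coeff_partial_sum_bound:
  assumes psi: "psi holomorphic_on unit_disc" "\<And>z. z \<in> unit_disc \<Longrightarrow> norm (psi z) \<le> M"
  shows "(\<Sum>n<N. (norm (taylor_coeff (\<lambda>z. psi z * h2_fun f z) n))\<^sup>2) \<le> (M * norm f)\<^sup>2"
proof -
  define g where "g = (\<lambda>z. psi z * h2_fun f z)"
  have g: "g holomorphic_on unit_disc"
    unfolding g_def by (intro holomorphic_intros psi(1) h2_fun_holomorphic)
  have le: "(\<Sum>n<N. (norm (taylor_coeff g n * of_real r ^ n))\<^sup>2) \<le> (M * norm f)\<^sup>2" if r: "0 < r" "r < 1" for r
  proof -
    have z: "of_real r * u \<in> unit_disc" if "norm u = 1" for u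
      using that r by (simp add: norm_mult)
    have fe: "(\<Sum>n. taylor_coeff F n * of_real r ^ n * u ^ n) = F (of_real r * u)"
      if "F holomorphic_on unit_disc" "norm u = 1" for F u
      using taylor_series_sums[OF that(1) z[OF that(2)]] by (simp add: sums_iff power_mult_distrib mult.assoc)
    have sf: "summable (\<lambda>n. norm (taylor_coeff F n * of_real r ^ n))"
      if "F holomorphic_on unit_disc" for F
      using r by (intro taylor_series_abs_summable that) auto
    have sq: "summable (\<lambda>n. (norm (taylor_coeff F n * of_real r ^ n))\<^sup>2)"
      if "F holomorphic_on unit_disc" for F
      using that by (intro summable_norm_power2 sf)
    have "(\<Sum>n<N. (norm (taylor_coeff g n * of_real r ^ n))\<^sup>2) \<le> (\<Sum>n. (norm (taylor_coeff g n * of_real r ^ n))\<^sup>2)"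
      by (rule sum_le_suminf[OF sq[OF g]]) auto
    also have "\<dots> \<le> M\<^sup>2 * (\<Sum>n. (norm (h2_coeff f n * of_real r ^ n))\<^sup>2)"
      unfolding h2_coeff_def
    proof (rule suminf_power2_le_if_dominated)
      show "norm (\<Sum>n. taylor_coeff g n * of_real r ^ n * u ^ n)
          \<le> M * norm (\<Sum>n. taylor_coeff (h2_fun f) n * of_real r ^ n * u ^ n)" if u: "norm u = 1" for u
        unfolding fe[OF g u] fe[OF h2_fun_holomorphic u]
        using psi(2)[OF z[OF u]] by (simp add: g_def norm_mult mult_right_mono)
    qed (intro sf g h2_fun_holomorphic)+
    also have "\<dots> \<le> M\<^sup>2 * (norm f)\<^sup>2"
      unfolding h2_norm_power2
    proof (intro mult_left_mono suminf_le h2_coeff_summable)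
      show "(norm (h2_coeff f n * of_real r ^ n))\<^sup>2 \<le> (norm (h2_coeff f n))\<^sup>2" for n
        using r by (intro power_mono) (auto simp: norm_mult norm_power power_le_one mult_left_le)
      show "summable (\<lambda>n. (norm (h2_coeff f n * of_real r ^ n))\<^sup>2)"
        unfolding h2_coeff_def by (rule sq[OF h2_fun_holomorphic])
    qed auto
    finally show ?thesis by (simp add: power_mult_distrib)
  qed
  \<comment> \<open>A finite sum is continuous in \<open>r\<close>, so the bound survives the limit
    \<open>r \<rightarrow> 1\<close> from the left.\<close>
  have "((\<lambda>r. \<Sum>n<N. (norm (taylor_coeff g n * of_real r ^ n))\<^sup>2) \<longlongrightarrow>
      (\<Sum>n<N. (norm (taylor_coeff g n * of_real 1 ^ n))\<^sup>2)) (at_left 1)"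
    by (intro tendsto_intros)
  moreover have "eventually (\<lambda>r::real. 0 < r \<and> r < 1) (at_left 1)"
    using eventually_at_left_real[of 0 1] by simp
  then have "eventually (\<lambda>r. (\<Sum>n<N. (norm (taylor_coeff g n * of_real r ^ n))\<^sup>2) \<le> (M * norm f)\<^sup>2) (at_left 1)"
    by eventually_elim (rule le, auto)
  ultimately have "(\<Sum>n<N. (norm (taylor_coeff g n * of_real 1 ^ n))\<^sup>2) \<le> (M * norm f)\<^sup>2"
    by (intro tendsto_upperbound[of _ _ "at_left (1::real)"]) auto
  then show ?thesis by (simp add: g_def)
qed

lemma mult_op:
  assumes psi: "psi holomorphic_on unit_disc" "\<And>z. z \<in> unit_disc \<Longrightarrow> norm (psi z) \<le> M"
  shows h2_fun_mult_op: "z \<in> unit_disc \<Longrightarrow> h2_fun (mult_op psi f) z = psi z * h2_fun f z"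
    and bounded_operator_mult_op: "bounded_operator (mult_op psi)"
proof -
  have hol: "(\<lambda>z. psi z * h2_fun f z) holomorphic_on unit_disc" for f
    by (intro holomorphic_intros psi(1) h2_fun_holomorphic)
  note partial = product_coeff_partial_sum_bound[OF psi]
  have sm: "summable (\<lambda>n. (norm (taylor_coeff (\<lambda>z. psi z * h2_fun f z) n))\<^sup>2)" for f
    by (rule summableI_nonneg_bounded[OF _ partial]) auto
  have "norm (psi 0) \<le> M" by (intro psi(2)) simp
  then have M: "M \<ge> 0" using norm_ge_zero order_trans by blast
  have fun_eq: "h2_fun (mult_op psi f) z = psi z * h2_fun f z" if "z \<in> unit_disc" for f z
    unfolding mult_op_def using h2_fun_h2_of[OF hol sm that] .
  have bound: "norm (mult_op psi f) \<le> M * norm f" for f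
    unfolding mult_op_def using partial M
    by (intro h2_norm_le_if_partial_sums) (auto simp: h2_coeff_h2_of[OF hol sm])
  have eqI: "f = g" if "\<And>z. z \<in> unit_disc \<Longrightarrow> h2_fun f z = h2_fun g z" for f g
  proof -
    have "h2_fun f z = h2_fun g z" for z
      using that h2_fun_outside by (cases "z \<in> unit_disc") auto
    then show ?thesis by (simp add: h2_fun_inject[symmetric] fun_eq_iff)
  qed
  show "z \<in> unit_disc \<Longrightarrow> h2_fun (mult_op psi f) z = psi z * h2_fun f z" by (rule fun_eq)
  show "bounded_operator (mult_op psi)"
    by (rule bounded_operatorI[OF _ _ bound]; rule eqI)
      (simp_all add: fun_eq plus_hardy2.rep_eq h2_cscale.rep_eq algebra_simps)
qed

lemma rotation_op:
  assumes lam: "norm lam = 1"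
  shows h2_fun_rotation_op: "z \<in> unit_disc \<Longrightarrow> h2_fun (rotation_op lam f) z = h2_fun f (lam * z)"
    and h2_coeff_rotation_op: "h2_coeff (rotation_op lam f) n = h2_coeff f n * lam ^ n"
    and bounded_operator_rotation_op: "bounded_operator (rotation_op lam)"
proof -
  have sums: "(\<lambda>n. (h2_coeff f n * lam ^ n) * z ^ n) sums h2_fun f (lam * z)" if "z \<in> unit_disc" for z f
    using h2_fun_sums[of "lam * z" f] that lam by (simp add: norm_mult power_mult_distrib mult.assoc)
  have nm: "norm (h2_coeff f n * lam ^ n) = norm (h2_coeff f n)" for f n
    using lam by (simp add: norm_mult norm_power)
  note P = power_series_taylor[OF sums]
  have sm: "summable (\<lambda>n. (norm (taylor_coeff (\<lambda>z. h2_fun f (lam * z)) n))\<^sup>2)" for f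
    by (simp only: P(2) nm h2_coeff_summable)
  show "z \<in> unit_disc \<Longrightarrow> h2_fun (rotation_op lam f) z = h2_fun f (lam * z)"
    unfolding rotation_op_def by (rule h2_fun_h2_of[OF P(1) sm])
  have coeff: "h2_coeff (rotation_op lam f) n = h2_coeff f n * lam ^ n" for f n
    unfolding rotation_op_def by (simp only: h2_coeff_h2_of[OF P(1) sm] P(2))
  then show "h2_coeff (rotation_op lam f) n = h2_coeff f n * lam ^ n" .
  have norm: "norm (rotation_op lam f) = norm f" for f
    by (simp only: norm_hardy2_def coeff nm)
  show "bounded_operator (rotation_op lam)"
    by (rule bounded_operatorI[of _ 1])
      (auto simp: coeff norm h2_coeff_plus h2_coeff_cscale algebra_simps intro!: h2_coeff_inject)
qed

lemma h2_cinner_rotation_op: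
  assumes "norm lam = 1"
  shows "h2_cinner (rotation_op lam f) g = h2_cinner f (rotation_op (cnj lam) g)"
  unfolding h2_cinner_def using assms by (simp add: h2_coeff_rotation_op mult_ac)

section \<open>Weakly null sequences\<close>

text \<open>Every coefficient is at most the norm, so a geometric series dominates. This crude
  growth bound makes bounded sequences locally uniformly bounded, as Montel's theorem
  requires.\<close>

lemma h2_fun_bound:
  assumes z: "z \<in> unit_disc"
  shows "norm (h2_fun f z) \<le> norm f / (1 - norm z)"
proof -
  have geo: "(\<lambda>n. norm f * norm z ^ n) sums (norm f * (1 / (1 - norm z)))"
    using z by (intro sums_mult geometric_sums) simp
  have "norm (\<Sum>n. h2_coeff f n * z ^ n) \<le> (\<Sum>n. norm f * norm z ^ n)"
    by (rule norm_suminf_le[OF _ sums_summable[OF geo]])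
      (simp add: norm_mult norm_power mult_right_mono h2_coeff_le_norm)
  then show ?thesis
    using sums_unique[OF geo] sums_unique[OF h2_fun_sums[OF z, of f]] by simp
qed

lemma h2_fun_le:
  assumes "norm f \<le> B" "norm z \<le> r" "r < 1"
  shows "norm (h2_fun f z) \<le> B / (1 - r)"
proof -
  have "norm (h2_fun f z) \<le> norm f / (1 - norm z)"
    using assms by (intro h2_fun_bound) simp
  also have "\<dots> \<le> B / (1 - r)"
    using assms order_trans[OF norm_ge_zero assms(1)] by (intro frac_le) auto
  finally show ?thesis .
qed

text \<open>Split \<open>y\<close> into a truncation and a small remainder. The pairing with the
  truncation is a finite combination of coefficients, and the bound \<open>B\<close> controls the
  pairing with the remainder.\<close>

lemma weakly_null_if_coeff_null:
  assumes B: "\<And>k. norm (f k) \<le> B"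
    and coeff: "\<And>n. (\<lambda>k. h2_coeff (f k) n) \<longlonglongrightarrow> 0"
  shows "(\<lambda>k. inner (f k) y) \<longlonglongrightarrow> 0"
proof (rule LIMSEQ_I)
  fix e :: real
  assume e: "e > 0"
  have B0: "B \<ge> 0" using B[of 0] norm_ge_zero order_trans by blast
  \<comment> \<open>\<open>B\<close> may be 0, so \<open>B + 1\<close> serves as divisor.\<close>
  have "e / (2 * (B + 1)) > 0" using e B0 by simp
  from metric_LIMSEQ_D[OF h2_truncate_tendsto this] obtain N where
    N: "norm (y - h2_truncate N y) < e / (2 * (B + 1))"
    by (metis dist_commute dist_norm order_refl)
  have cinner: "h2_cinner (f k) (h2_truncate N y) = (\<Sum>n<N. h2_coeff (f k) n * cnj (h2_coeff y n))" for k
  proof -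
    have "h2_cinner (f k) (h2_truncate N y) =
        (\<Sum>n<N. h2_coeff (f k) n * cnj (h2_coeff (h2_truncate N y) n))"
      unfolding h2_cinner_def by (rule suminf_finite) (auto simp: h2_coeff_truncate)
    then show ?thesis by (simp add: h2_coeff_truncate)
  qed
  have "(\<lambda>k. \<Sum>n<N. h2_coeff (f k) n * cnj (h2_coeff y n)) \<longlonglongrightarrow> (\<Sum>n<N. 0 * cnj (h2_coeff y n))"
    by (intro tendsto_intros coeff)
  then have "(\<lambda>k. h2_cinner (f k) (h2_truncate N y)) \<longlonglongrightarrow> 0" by (simp add: cinner)
  from LIMSEQ_D[OF this, of "e / 2"] e obtain k0 where
    k0: "\<And>k. k \<ge> k0 \<Longrightarrow> norm (h2_cinner (f k) (h2_truncate N y)) < e / 2" by auto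
  have "norm (inner (f k) y - 0) < e" if "k \<ge> k0" for k
  proof -
    have "\<bar>inner (f k) (h2_truncate N y)\<bar> < e / 2"
      using k0[OF that] abs_Re_le_cmod[of "h2_cinner (f k) (h2_truncate N y)"]
      by (simp add: inner_hardy2_def)
    moreover have "\<bar>inner (f k) (y - h2_truncate N y)\<bar> \<le> e / 2"
    proof -
      have "\<bar>inner (f k) (y - h2_truncate N y)\<bar> \<le> norm (f k) * norm (y - h2_truncate N y)"
        by (rule Cauchy_Schwarz_ineq2)
      also have "\<dots> \<le> (B + 1) * (e / (2 * (B + 1)))"
        using N B[of k] B0 by (intro mult_mono) auto
      also have "\<dots> = e / 2" using B0 by (simp add: field_simps)
      finally show ?thesis .
    qed
    moreover have "inner (f k) y = inner (f k) (h2_truncate N y) + inner (f k) (y - h2_truncate N y)"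
      by (simp flip: inner_add_right)
    ultimately show ?thesis by simp
  qed
  then show "\<exists>k0. \<forall>k\<ge>k0. norm (inner (f k) y - 0) < e" by blast
qed

lemma compact_subset_disc_bound:
  assumes "compact K" "K \<subseteq> (unit_disc :: complex set)"
  obtains \<rho> where "0 \<le> \<rho>" "\<rho> < 1" "K \<subseteq> cball 0 \<rho>"
proof (cases "K = {}")
  case False
  then obtain x where "x \<in> K" "\<And>z. z \<in> K \<Longrightarrow> norm z \<le> norm x"
    using continuous_attains_sup[OF assms(1), of norm] by (auto intro: continuous_on_norm_id)
  then show ?thesis using assms(2) by (intro that[of "norm x"]) auto
qed (auto intro: that[of 0])

text \<open>If some coefficient did not tend to 0, it would stay away from 0 along a subsequence.
  Montel's theorem extracts from it a further subsequence converging locally uniformly, to 0 by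
  assumption; then the derivatives at 0 converge to 0 as well, a contradiction.\<close>

lemma weakly_null_if_limits_zero:
  assumes B: "\<And>k. norm (f k) \<le> B"
    and zero: "\<And>r g z. strict_mono r \<Longrightarrow> g holomorphic_on unit_disc \<Longrightarrow>
      (\<And>K. compact K \<Longrightarrow> K \<subseteq> unit_disc \<Longrightarrow> uniform_limit K (\<lambda>k. h2_fun (f (r k))) g sequentially) \<Longrightarrow>
      z \<in> unit_disc \<Longrightarrow> g z = 0"
  shows "(\<lambda>k. inner (f k) y) \<longlonglongrightarrow> 0"
proof (rule weakly_null_if_coeff_null[OF B])
  fix n
  show "(\<lambda>k. h2_coeff (f k) n) \<longlonglongrightarrow> 0"
  proof (rule ccontr)
    assume "\<not> (\<lambda>k. h2_coeff (f k) n) \<longlonglongrightarrow> 0"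
    then obtain e where e: "e > 0" "\<And>k0. \<exists>k\<ge>k0. \<not> norm (h2_coeff (f k) n) < e"
      by (auto simp: LIMSEQ_iff)
    then have "infinite {k. \<not> norm (h2_coeff (f k) n) < e}"
      unfolding infinite_nat_iff_unbounded_le by simp
    from infinite_enumerate[OF this]
    obtain s :: "nat \<Rightarrow> nat" where s: "strict_mono s" "\<forall>k. s k \<in> {k. \<not> norm (h2_coeff (f k) n) < e}"
      by blast
    obtain g r where g: "g holomorphic_on unit_disc" "strict_mono r"
      and lim: "\<And>K. compact K \<Longrightarrow> K \<subseteq> unit_disc \<Longrightarrow>
        uniform_limit K ((\<lambda>k. h2_fun (f (s k))) \<circ> r) g sequentially"
    proof (rule Montel[of unit_disc "range (\<lambda>k. h2_fun (f (s k)))" "\<lambda>k. h2_fun (f (s k))"])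
      fix K :: "complex set"
      assume K: "compact K" "K \<subseteq> unit_disc"
      obtain \<rho> where \<rho>: "\<rho> < 1" "K \<subseteq> cball 0 \<rho>"
        using compact_subset_disc_bound[OF K] by blast
      have "norm (h2_fun (f (s k)) z) \<le> B / (1 - \<rho>)" if "z \<in> K" for k z
        using that \<rho> by (intro h2_fun_le B) auto
      then show "\<exists>B. \<forall>h\<in>range (\<lambda>k. h2_fun (f (s k))). \<forall>z\<in>K. norm (h z) \<le> B" by blast
    qed (auto intro: h2_fun_holomorphic)
    have g0: "g z = 0" if "z \<in> unit_disc" for z
      using zero[of "s \<circ> r" g z] strict_mono_o[OF s(1) g(2)] g(1) lim that by (simp add: o_def)
    have "uniform_limit (ball 0 (1/2)) (\<lambda>k. h2_fun (f (s (r k)))) g sequentially"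
    proof (rule uniform_limit_on_subset)
      have "cball 0 (1/2) \<subseteq> (unit_disc :: complex set)" by auto
      then show "uniform_limit (cball 0 (1/2)) (\<lambda>k. h2_fun (f (s (r k)))) g sequentially"
        using lim[of "cball 0 (1/2)"] by (simp add: o_def)
    qed auto
    then have "(\<lambda>k. (deriv ^^ n) (h2_fun (f (s (r k)))) 0) \<longlonglongrightarrow> (deriv ^^ n) g 0"
      by (rule higher_deriv_complex_uniform_limit)
        (auto intro!: always_eventually holomorphic_on_subset[OF h2_fun_holomorphic])
    moreover have "(deriv ^^ n) g 0 = (deriv ^^ n) (\<lambda>_. 0) 0"
    proof (rule higher_deriv_cong_ev)
      have "eventually (\<lambda>w. w \<in> unit_disc) (nhds (0::complex))"
        by (intro eventually_nhds_in_open) auto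
      then show "eventually (\<lambda>w. g w = 0) (nhds 0)" by eventually_elim (rule g0)
    qed simp
    ultimately have "(\<lambda>k. (deriv ^^ n) (h2_fun (f (s (r k)))) 0 / fact n) \<longlonglongrightarrow> 0 / fact n"
      by (intro tendsto_intros) simp_all
    then have "(\<lambda>k. h2_coeff (f (s (r k))) n) \<longlonglongrightarrow> 0"
      by (simp add: h2_coeff_def taylor_coeff_def)
    from LIMSEQ_D[OF this e(1)] s(2) show False by auto
  qed
qed

text \<open>Every locally uniform limit vanishes on the small disc, hence on the whole unit disc by
  the identity theorem.\<close>

lemma weakly_null_if_null_near_0:
  assumes B: "\<And>k. norm (f k) \<le> B" and \<rho>: "0 < \<rho>" "\<rho> < 1"
    and le: "\<And>k z. norm z \<le> \<rho> \<Longrightarrow> norm (h2_fun (f k) z) \<le> p k" and p: "p \<longlonglongrightarrow> (0::real)"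
  shows "(\<lambda>k. inner (f k) y) \<longlonglongrightarrow> 0"
proof (rule weakly_null_if_limits_zero[OF B])
  fix r :: "nat \<Rightarrow> nat" and g z
  assume r: "strict_mono r" and g: "g holomorphic_on unit_disc" and z: "z \<in> unit_disc"
    and lim: "\<And>K. compact K \<Longrightarrow> K \<subseteq> unit_disc \<Longrightarrow> uniform_limit K (\<lambda>k. h2_fun (f (r k))) g sequentially"
  have "g w = 0" if w: "w \<in> ball 0 \<rho>" for w
  proof (rule LIMSEQ_unique)
    show "(\<lambda>k. h2_fun (f (r k)) w) \<longlonglongrightarrow> g w"
      using w \<rho> by (intro tendsto_uniform_limitI[OF lim[of "{w}"]]) auto
    show "(\<lambda>k. h2_fun (f (r k)) w) \<longlonglongrightarrow> 0"
    proof (rule Lim_null_comparison)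
      show "eventually (\<lambda>k. norm (h2_fun (f (r k)) w) \<le> (p \<circ> r) k) sequentially"
        using w by (auto intro!: always_eventually le)
      show "(p \<circ> r) \<longlonglongrightarrow> 0" by (rule LIMSEQ_subseq_LIMSEQ[OF p r])
    qed
  qed
  then show "g z = 0"
    using analytic_continuation_open[of "ball 0 \<rho>" unit_disc g "\<lambda>_. 0" z] \<rho> z g
      subset_ball[of \<rho> 1 "0 :: complex"] by auto
qed

text \<open>
  A nonzero limit of the \<open>f\<^sub>k\<close> is bounded away from 0 on some circle around the given compact set.
  There the \<open>F\<^sub>k\<close> are then bounded, and by the maximum principle also on the compact set.
\<close>

lemma weakly_null_if_multiplier_unbounded:
  assumes B: "\<And>k. norm (f k) \<le> B"
    and F: "\<And>k. F k holomorphic_on unit_disc"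
    and K: "compact K" "K \<subseteq> unit_disc"
    and large: "\<And>k. \<exists>z\<in>K. norm (F k z) \<ge> real k"
    and prod: "\<And>\<rho>. 0 \<le> \<rho> \<Longrightarrow> \<rho> < 1 \<Longrightarrow> \<exists>C. \<forall>k z. norm z = \<rho> \<longrightarrow> norm (F k z * h2_fun (f k) z) \<le> C"
  shows "(\<lambda>k. inner (f k) y) \<longlonglongrightarrow> 0"
proof (rule weakly_null_if_limits_zero[OF B], rule ccontr)
  fix r :: "nat \<Rightarrow> nat" and g z
  assume r: "strict_mono r" and g: "g holomorphic_on unit_disc" and z: "z \<in> unit_disc" "g z \<noteq> 0"
    and lim: "\<And>K. compact K \<Longrightarrow> K \<subseteq> unit_disc \<Longrightarrow> uniform_limit K (\<lambda>k. h2_fun (f (r k))) g sequentially"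
  obtain \<rho>0 where \<rho>0: "0 \<le> \<rho>0" "\<rho>0 < 1" "K \<subseteq> cball 0 \<rho>0"
    using compact_subset_disc_bound[OF K] .
  \<comment> \<open>The radius lies strictly between \<open>\<rho>0\<close> and 1, so the closed
    disc is compact in the unit disc and leaves room for a circle around \<open>K\<close>. The
    theorem on finitely many zeros concerns nonconstant functions; a constant \<open>g\<close> has
    no zeros since \<open>g z \<noteq> 0\<close>.\<close>
  have finite_zeros: "finite {w \<in> cball 0 ((1 + \<rho>0) / 2). g w = 0}"
  proof (cases "g constant_on unit_disc")
    case True
    then have "g w \<noteq> 0" if "w \<in> unit_disc" for w
      using z that by (auto simp: constant_on_def)
    then have "{w \<in> cball 0 ((1 + \<rho>0) / 2). g w = 0} = {}"
      using \<rho>0 by (auto simp: not_le)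
    then show ?thesis by (simp only: finite.emptyI)
  next
    case False
    then show ?thesis
      using \<rho>0 by (intro holomorphic_compact_finite_zeros[OF g]) auto
  qed
  \<comment> \<open>Finitely many zeros have finitely many moduli, so some radius in this interval
    gives a circle free of zeros.\<close>
  have "infinite {\<rho>0<..<(1 + \<rho>0) / 2}" using \<rho>0 by (intro infinite_Ioo) simp
  from Diff_infinite_finite[OF finite_imageI[OF finite_zeros, of norm] this]
  have "{\<rho>0<..<(1 + \<rho>0) / 2} - norm ` {w \<in> cball 0 ((1 + \<rho>0) / 2). g w = 0} \<noteq> {}"
    by (rule infinite_imp_nonempty)
  then obtain \<rho> where \<rho>: "\<rho>0 < \<rho>" "\<rho> < (1 + \<rho>0) / 2"
      "\<rho> \<notin> norm ` {w \<in> cball 0 ((1 + \<rho>0) / 2). g w = 0}"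
    by fastforce
  have \<rho>1: "0 < \<rho>" "\<rho> < 1" using \<rho> \<rho>0 by auto
  have g_nz: "g w \<noteq> 0" if "norm w = \<rho>" for w
    using \<rho> that by (auto simp: image_iff)
  have sphere: "compact (sphere 0 \<rho> :: complex set)" "sphere 0 \<rho> \<subseteq> (unit_disc :: complex set)"
    using \<rho>1 by auto
  have "(of_real \<rho> :: complex) \<in> sphere 0 \<rho>" using \<rho>1 by simp
  then have "\<exists>w\<in>sphere 0 \<rho>. \<forall>v\<in>sphere 0 \<rho>. norm (g w) \<le> norm (g v)"
    using sphere g
    by (intro continuous_attains_inf continuous_on_norm holomorphic_on_imp_continuous_on
        holomorphic_on_subset[OF g]) auto
  then obtain w0 where w0: "norm w0 = \<rho>" "\<And>v. norm v = \<rho> \<Longrightarrow> norm (g w0) \<le> norm (g v)" by auto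
  \<comment> \<open>Half the minimum of \<open>|g|\<close> on the circle: functions within
    \<open>c\<close> of \<open>g\<close> there still have modulus at least \<open>c\<close>.\<close>
  define c where "c = norm (g w0) / 2"
  have c: "c > 0" using g_nz[OF w0(1)] by (simp add: c_def)
  have "eventually (\<lambda>k. \<forall>w\<in>sphere 0 \<rho>. dist (h2_fun (f (r k)) w) (g w) < c) sequentially"
    using uniform_limitD[OF lim[OF sphere] c] .
  then obtain k0 where "\<forall>k\<ge>k0. \<forall>w\<in>sphere 0 \<rho>. dist (h2_fun (f (r k)) w) (g w) < c"
    unfolding eventually_sequentially by blast
  then have k0: "dist (h2_fun (f (r k)) w) (g w) < c" if "k \<ge> k0" "norm w = \<rho>" for k w
    using that by simp
  obtain C where C: "\<And>k w. norm w = \<rho> \<Longrightarrow> norm (F k w * h2_fun (f k) w) \<le> C"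
    using prod[of \<rho>] \<rho>1 by auto
  have Fle: "norm (F (r k) w) \<le> C / c" if "k \<ge> k0" "w \<in> cball 0 \<rho>" for k w
  proof (rule maximum_modulus_frontier[where f = "F (r k)" and S = "cball 0 \<rho>"])
    show "F (r k) holomorphic_on interior (cball 0 \<rho>)"
      using \<rho>1 by (intro holomorphic_on_subset[OF F]) auto
    have "F (r k) holomorphic_on cball 0 \<rho>"
      by (rule holomorphic_on_subset[OF F]) (use \<rho>1 in auto)
    then show "continuous_on (closure (cball 0 \<rho>)) (F (r k))"
      by (simp add: holomorphic_on_imp_continuous_on)
    show "norm (F (r k) v) \<le> C / c" if "v \<in> frontier (cball 0 \<rho>)" for v
    proof -
      have v: "norm v = \<rho>" using that \<rho>1 by (simp add: frontier_cball)
      have "norm (g v) \<le> norm (h2_fun (f (r k)) v) + dist (h2_fun (f (r k)) v) (g v)"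
        using norm_triangle_sub[of "g v" "h2_fun (f (r k)) v"] by (simp add: dist_norm norm_minus_commute)
      then have "c \<le> norm (h2_fun (f (r k)) v)"
        using k0[OF \<open>k \<ge> k0\<close> v] w0(2)[OF v] by (simp add: c_def)
      then have "norm (F (r k) v) * c \<le> norm (F (r k) v * h2_fun (f (r k)) v)"
        by (simp add: norm_mult mult_left_mono)
      also have "\<dots> \<le> C" by (rule C[OF v])
      finally show ?thesis using c by (simp add: pos_le_divide_eq)
    qed
  qed (use that in auto)
  \<comment> \<open>\<open>k\<close> is past the threshold \<open>k0\<close> and exceeds
    \<open>C / c\<close>. Since \<open>r k \<ge> k\<close>, the lower bound \<open>large\<close> at
    index \<open>r k\<close> contradicts \<open>Fle\<close>.\<close>
  obtain k where "max (C / c) (real k0) < real k"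
    using reals_Archimedean2 by blast
  then have k: "k \<ge> k0" "real k > C / c" by auto
  obtain w where w: "w \<in> K" "norm (F (r k) w) \<ge> real (r k)" using large by blast
  have "real k \<le> real (r k)" using strict_mono_imp_increasing[OF r, of k] by simp
  then show False
    using Fle[OF k(1), of w] w k(2) \<rho>0(3) \<rho>(1) by auto
qed

section \<open>The operator with a rotated symbol\<close>

lemma norm_prod_le_power:
  fixes f :: "nat \<Rightarrow> 'a::{real_normed_field}"
  assumes "\<And>j. j < n \<Longrightarrow> norm (f j) \<le> q"
  shows "norm (\<Prod>j<n. f j) \<le> q ^ n"
  using prod_mono[of "{..<n}" "\<lambda>j. norm (f j)" "\<lambda>_. q"] assms by (simp add: prod_norm)

lemma norm_prod_ge_power:
  fixes f :: "nat \<Rightarrow> 'a::{real_normed_field}"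
  assumes "\<And>j. j < n \<Longrightarrow> q \<le> norm (f j)" "0 \<le> q"
  shows "q ^ n \<le> norm (\<Prod>j<n. f j)"
  using prod_mono[of "{..<n}" "\<lambda>_. q" "\<lambda>j. norm (f j)"] assms by (simp add: prod_norm)

lemma irrational_rotation_norm: "irrational_rotation lam \<Longrightarrow> norm lam = 1"
  by (auto simp: irrational_rotation_def norm_exp_eq_Re)

text \<open>Two equal powers would give \<open>lam ^ n = 1\<close> for some \<open>n > 0\<close>,
  making \<open>n * \<theta>\<close> an integer. It provides the infinite orbits on which limits are
  shown to vanish.\<close>

lemma irrational_rotation_power_inj:
  assumes "irrational_rotation lam"
  shows "inj (\<lambda>n::nat. lam ^ n)"
proof -
  obtain \<theta> :: real where \<theta>: "\<theta> \<notin> \<rat>" "lam = exp (2 * of_real pi * \<i> * of_real \<theta>)"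
    using assms by (auto simp: irrational_rotation_def)
  have ne: "lam ^ n \<noteq> 1" if "n > 0" for n
  proof
    assume "lam ^ n = 1"
    then have "exp (of_nat n * (2 * of_real pi * \<i> * of_real \<theta>)) = 1"
      by (simp only: \<theta>(2) exp_of_nat_mult)
    then obtain m :: int where "Im (of_nat n * (2 * of_real pi * \<i> * of_real \<theta>)) = of_int (2 * m) * pi"
      unfolding exp_eq_1 by blast
    then have "real n * \<theta> = of_int m" by simp
    then have "\<theta> = of_int m / of_nat n" using that by (simp add: field_simps)
    then show False using \<theta>(1) by (simp add: Rats_divide)
  qed
  have nz: "lam \<noteq> 0" using irrational_rotation_norm[OF assms] by auto
  have "n = m" if "lam ^ n = lam ^ m" "n \<le> m" for n m
  proof (rule ccontr)
    assume "n \<noteq> m"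
    then have "m - n > 0" using that by simp
    moreover have "lam ^ m = lam ^ n * lam ^ (m - n)"
      using power_add[of lam n "m - n"] that(2) by simp
    then have "lam ^ (m - n) = 1" using that nz by simp
    ultimately show False using ne by blast
  qed
  then show ?thesis by (metis injI nat_le_linear)
qed

lemma conj_symbol_holomorphic:
  assumes "\<phi> holomorphic_on unit_disc"
  shows "conj_symbol \<phi> holomorphic_on unit_disc"
proof -
  have "cnj ` unit_disc = unit_disc"
    by (auto simp: image_iff intro!: exI[of _ "cnj _"] bexI[of _ "cnj _"])
  then have "cnj \<circ> \<phi> \<circ> cnj holomorphic_on unit_disc"
    using assms by (intro holomorphic_on_compose_cnj_cnj) auto
  then show ?thesis by (simp add: conj_symbol_def[abs_def] o_def)
qed

lemma cnj_unit: "norm lam = 1 \<Longrightarrow> lam * cnj lam = 1"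
  by (simp flip: complex_norm_square)

lemma not_unif_bounded_on_compactsE:
  assumes "\<not> unif_bounded_on_compacts m"
  obtains K where "compact K" "K \<subseteq> unit_disc"
    "\<forall>C::real. \<exists>n\<ge>1. \<exists>z\<in>K. ennreal C < m n z"
proof -
  from assms obtain K where K: "compact K \<and> K \<subseteq> unit_disc"
    "\<not> (\<exists>C::real. \<forall>n\<ge>1. \<forall>z\<in>K. m n z \<le> ennreal C)"
    unfolding unif_bounded_on_compacts_def by blast
  have "\<exists>n\<ge>1. \<exists>z\<in>K. ennreal C < m n z" for C :: real
  proof -
    have "\<not> (\<forall>n\<ge>1. \<forall>z\<in>K. m n z \<le> ennreal C)" using K(2) by blast
    then show ?thesis by (simp add: not_le)
  qed
  then show ?thesis using K(1) by (intro that) auto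
qed

section \<open>The adjoint operator and its powers\<close>

locale rotated_symbol =
  fixes lam :: complex and \<phi> :: "complex \<Rightarrow> complex"
  assumes lam: "norm lam = 1" and phi: "\<phi> \<in> H_infinity"
begin

abbreviation "psi \<equiv> conj_symbol \<phi>"

text \<open>One product serves both families: \<open>Omega lam \<phi> n\<close> is this function
  after a rotation of the variable, and \<open>Phi lam \<phi> n\<close> is its conjugate at the
  conjugate point.\<close>

abbreviation "psi_prod n \<equiv> conj_symbol (Phi lam \<phi> n)"

definition "T = rotation_op lam \<circ> backward_shift_calculus \<phi>"

definition "S = mult_op psi \<circ> rotation_op (cnj lam)"

lemma norm_cnj_lam: "norm (cnj lam) = 1"
  using lam by simp

lemma norm_lam_power: "norm (lam ^ n * z) = norm z" "norm (cnj lam ^ n * z) = norm z"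
  using lam by (simp_all add: norm_mult norm_power)

lemma cnj_lam_power: "cnj lam ^ n * (lam ^ n * z) = z" "lam ^ n * (cnj lam ^ n * z) = z"
proof -
  have "lam ^ n * cnj lam ^ n = 1"
    unfolding power_mult_distrib[symmetric] cnj_unit[OF lam] by simp
  moreover have "cnj lam ^ n * (lam ^ n * z) = (lam ^ n * cnj lam ^ n) * z"
    "lam ^ n * (cnj lam ^ n * z) = (lam ^ n * cnj lam ^ n) * z"
    by (simp_all only: mult_ac)
  ultimately show "cnj lam ^ n * (lam ^ n * z) = z" "lam ^ n * (cnj lam ^ n * z) = z" by simp_all
qed

lemma phi_holomorphic: "\<phi> holomorphic_on unit_disc"
  using phi by (simp add: H_infinity_def)

lemma psi_holomorphic: "psi holomorphic_on unit_disc"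
  by (intro conj_symbol_holomorphic phi_holomorphic)

lemma phi_bound:
  obtains M where "M \<ge> 1" "\<And>z. z \<in> unit_disc \<Longrightarrow> norm (\<phi> z) \<le> M"
proof -
  obtain M where "\<forall>w\<in>\<phi> ` unit_disc. norm w \<le> M"
    using phi unfolding H_infinity_def bounded_iff by blast
  then show ?thesis by (intro that[of "max M 1"]) (auto simp: le_max_iff_disj)
qed

lemma psi_bound:
  obtains M where "M \<ge> 1" "\<And>z. z \<in> unit_disc \<Longrightarrow> norm (psi z) \<le> M"
proof -
  obtain M where M: "M \<ge> 1" "\<And>z. z \<in> unit_disc \<Longrightarrow> norm (\<phi> z) \<le> M"
    using phi_bound by blast
  have "norm (psi z) \<le> M" if "z \<in> unit_disc" for z
    using M(2)[of "cnj z"] that by (simp add: conj_symbol_def)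
  then show ?thesis using M(1) by (rule that[rotated])
qed

lemma bounded_operator_mult_psi: "bounded_operator (mult_op psi)"
proof -
  obtain M where M: "\<And>z. z \<in> unit_disc \<Longrightarrow> norm (psi z) \<le> M" using psi_bound by blast
  show ?thesis by (rule bounded_operator_mult_op[OF psi_holomorphic M])
qed

lemma bounded_operator_comp: "bounded_operator A \<Longrightarrow> bounded_operator A' \<Longrightarrow> bounded_operator (A \<circ> A')"
  unfolding bounded_operator_def by (auto intro: bounded_linear_compose simp: o_def)

lemma bounded_operator_T: "bounded_operator T"
  unfolding T_def backward_shift_calculus_def
  by (intro bounded_operator_comp bounded_operator_rotation_op lam h2_adjoint(2) bounded_operator_mult_psi)

lemma bounded_operator_S: "bounded_operator S"
  unfolding S_def
  by (intro bounded_operator_comp bounded_operator_rotation_op norm_cnj_lam bounded_operator_mult_psi)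

lemma adjoint_T_S: "inner (T f) g = inner f (S g)"
proof -
  have "h2_cinner (T f) g = h2_cinner (h2_adjoint (mult_op psi) f) (rotation_op (cnj lam) g)"
    by (simp add: T_def backward_shift_calculus_def h2_cinner_rotation_op[OF lam])
  \<comment> \<open>\<open>h2_adjoint\<close> moves an operator from the left slot to the right,
    while here it must move back. Conjugate symmetry is used before and after.\<close>
  also have "\<dots> = cnj (h2_cinner (rotation_op (cnj lam) g) (h2_adjoint (mult_op psi) f))"
    by (rule h2_cinner_commute)
  also have "\<dots> = cnj (h2_cinner (S g) f)"
    by (simp add: S_def h2_adjoint(1)[OF bounded_operator_mult_psi])
  also have "\<dots> = h2_cinner f (S g)" by (rule h2_cinner_commute[symmetric])
  finally show ?thesis by (simp add: inner_hardy2_def)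
qed

lemma psi_prod: "psi_prod n z = (\<Prod>j<n. psi (cnj lam ^ j * z))"
  by (simp add: conj_symbol_def Phi_def)

lemma psi_prod_Suc: "psi_prod (Suc n) z = psi z * psi_prod n (cnj lam * z)"
  unfolding psi_prod prod.lessThan_Suc_shift by (simp add: mult_ac)

text \<open>On the unit circle \<open>1 / cnj lam = lam\<close>. At \<open>lam ^ n * z\<close> the
  factors of \<open>psi_prod n\<close> are taken at \<open>lam ^ (n - j) * z\<close> for
  \<open>j < n\<close>, which are the factors of \<open>Omega\<close> in reverse order.\<close>

lemma Omega_eq: "Omega lam \<phi> n z = psi_prod n (lam ^ n * z)"
proof -
  have "cnj lam \<noteq> 0" using lam by auto
  then have "1 / cnj lam = lam" using cnj_unit[OF lam] by (simp add: divide_eq_eq)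
  then have "Omega lam \<phi> n z = (\<Prod>j=1..n. psi (lam ^ j * z))" by (simp add: Omega_def)
  also have "\<dots> = psi_prod n (lam ^ n * z)"
  proof (induction n)
    case 0
    then show ?case by (simp add: psi_prod)
  next
    case (Suc n)
    have "cnj lam * (lam ^ Suc n * z) = lam ^ n * z"
      using cnj_lam_power(1)[of 1 "lam ^ n * z"] by (simp add: mult_ac)
    then have "psi_prod (Suc n) (lam ^ Suc n * z) = psi (lam ^ Suc n * z) * psi_prod n (lam ^ n * z)"
      by (simp only: psi_prod_Suc)
    then show ?case by (simp add: Suc[unfolded One_nat_def] mult.commute[of "psi_prod n (lam ^ n * z)"])
  qed
  finally show ?thesis .
qed

lemma psi_prod_holomorphic: "psi_prod n holomorphic_on unit_disc"
  unfolding psi_prod[abs_def]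
  by (intro holomorphic_intros holomorphic_on_compose_gen[OF _ psi_holomorphic, unfolded o_def])
    (use lam in \<open>auto simp: norm_mult norm_power\<close>)

lemma Omega_holomorphic: "Omega lam \<phi> n holomorphic_on unit_disc"
  unfolding Omega_eq[abs_def]
  by (intro holomorphic_intros holomorphic_on_compose_gen[OF _ psi_prod_holomorphic, unfolded o_def])
    (use lam in \<open>auto simp: norm_mult norm_power\<close>)

lemma h2_fun_S:
  assumes "z \<in> unit_disc"
  shows "h2_fun (S g) z = psi z * h2_fun g (cnj lam * z)"
proof -
  obtain M where M: "\<And>z. z \<in> unit_disc \<Longrightarrow> norm (psi z) \<le> M" using psi_bound by blast
  show ?thesis
    using h2_fun_mult_op[OF psi_holomorphic M assms] h2_fun_rotation_op[OF norm_cnj_lam assms]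
    by (simp add: S_def)
qed

lemma S_power:
  assumes "z \<in> unit_disc"
  shows "h2_fun ((S ^^ n) g) z = psi_prod n z * h2_fun g (cnj lam ^ n * z)"
  using assms
proof (induction n arbitrary: z)
  case 0
  then show ?case by (simp add: psi_prod)
next
  case (Suc n)
  have z: "cnj lam * z \<in> unit_disc" using Suc.prems lam by (simp add: norm_mult)
  have "h2_fun ((S ^^ Suc n) g) z = psi z * h2_fun ((S ^^ n) g) (cnj lam * z)"
    using h2_fun_S[OF Suc.prems] by simp
  also have "\<dots> = psi_prod (Suc n) z * h2_fun g (cnj lam ^ Suc n * z)"
    unfolding Suc.IH[OF z] psi_prod_Suc by (simp add: mult_ac)
  finally show ?case .
qed

text \<open>The substitution of \<open>lam ^ n * z\<close> undoes the rotation inside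
  \<open>g\<close>. It preserves every circle around 0, so bounds on circles carry over between
  \<open>S ^^ n\<close> and multiplication by \<open>Omega\<close>.\<close>

lemma S_power_rotated:
  assumes "z \<in> unit_disc"
  shows "h2_fun ((S ^^ n) g) (lam ^ n * z) = Omega lam \<phi> n z * h2_fun g z"
  using assms S_power[of "lam ^ n * z" n g] norm_lam_power(1)[of n z]
  by (simp add: Omega_eq cnj_lam_power)

lemma hypercyclic_criterion:
  assumes image_null: "\<And>h y B. (\<And>k. norm (h k) \<le> B) \<Longrightarrow> (\<And>k. norm ((S ^^ N k) (h k)) \<le> B) \<Longrightarrow>
        (\<lambda>k. inner ((S ^^ N k) (h k)) y) \<longlonglongrightarrow> 0"
    and preimage_null: "\<And>h y B. (\<And>k. norm (h k) \<le> B) \<Longrightarrow> (\<And>k. norm ((S ^^ N k) (h k)) \<le> B) \<Longrightarrow>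
        (\<lambda>k. inner (h k) y) \<longlonglongrightarrow> 0"
  shows "hypercyclic T"
proof -
  obtain D :: "hardy2 set" where D: "countable D" "closure D = UNIV"
    using h2_countable_dense by blast
  have common: "\<exists>B. (\<forall>k. norm (h k) \<le> B) \<and> (\<forall>k. norm ((S ^^ N k) (h k)) \<le> B)"
    if "bounded (range h)" "bounded (range (\<lambda>k. (S ^^ N k) (h k)))" for h
  proof -
    from that obtain B B' where "\<forall>k. norm (h k) \<le> B" "\<forall>k. norm ((S ^^ N k) (h k)) \<le> B'"
      unfolding bounded_iff by blast
    then show ?thesis by (intro exI[of _ "max B B'"]) (simp add: le_max_iff_disj)
  qed
  have "\<exists>f. closure (range (\<lambda>n. (T ^^ n) f)) = UNIV"
    using bounded_operator_T bounded_operator_S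
  proof (intro dense_orbit_criterion[OF _ _ adjoint_T_S D])
    fix h y
    assume bdd: "bounded (range h)" "bounded (range (\<lambda>k. (S ^^ N k) (h k)))"
    obtain B where "\<And>k. norm (h k) \<le> B" "\<And>k. norm ((S ^^ N k) (h k)) \<le> B"
      using common[OF bdd] by blast
    then show "(\<lambda>k. inner ((S ^^ N k) (h k)) y) \<longlonglongrightarrow> 0" "(\<lambda>k. inner (h k) y) \<longlonglongrightarrow> 0"
      by (rule image_null, rule preimage_null)
  qed (auto simp: bounded_operator_def)
  then show ?thesis using bounded_operator_T by (simp add: hypercyclic_def)
qed

lemma psi_near_0:
  assumes "open U" "psi 0 \<in> U"
  obtains \<rho> where "0 < \<rho>" "\<rho> < 1" "\<And>z. norm z \<le> \<rho> \<Longrightarrow> psi z \<in> U"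
proof -
  have "open (psi -` U \<inter> unit_disc)"
    using holomorphic_on_imp_continuous_on[OF psi_holomorphic] assms(1)
    by (simp add: continuous_on_open_vimage)
  moreover have "0 \<in> psi -` U \<inter> unit_disc" using assms(2) by simp
  ultimately obtain e where e: "e > 0" "ball 0 e \<subseteq> psi -` U \<inter> unit_disc"
    by (rule openE)
  have "psi z \<in> U" if "norm z \<le> min e 1 / 2" for z
  proof -
    have "z \<in> ball 0 e" using that e(1) by (auto simp: min_def split: if_splits)
    then show ?thesis using e(2) by blast
  qed
  then show ?thesis using e(1) by (intro that[of "min e 1 / 2"]) (auto simp: min_def)
qed

section \<open>The case of a contracting value at 0\<close>

lemma hypercyclic_if_Omega_unbounded:
  assumes unbounded: "\<not> unif_bounded_on_compacts (\<lambda>n z. ennreal (norm (Omega lam \<phi> n z)))"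
    and less: "norm (\<phi> 0) < 1"
  shows "hypercyclic T"
proof -
  obtain M where M: "M \<ge> 1" "\<And>z. z \<in> unit_disc \<Longrightarrow> norm (psi z) \<le> M" using psi_bound by blast
  obtain q where q: "norm (\<phi> 0) < q" "q < 1" using dense[OF less] by blast
  have q0: "0 \<le> q" using q(1) norm_ge_zero[of "\<phi> 0"] by linarith
  obtain \<rho> where \<rho>: "0 < \<rho>" "\<rho> < 1" "\<And>z. norm z \<le> \<rho> \<Longrightarrow> psi z \<in> ball 0 q"
    using psi_near_0[of "ball 0 q"] q(1) by (auto simp: conj_symbol_def)
  have small: "norm (psi_prod n z) \<le> q ^ n" if "norm z \<le> \<rho>" for n z
  proof -
    have "norm (psi w) \<le> q" if "norm w \<le> \<rho>" for w using \<rho>(3)[OF that] by simp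
    then show ?thesis
      unfolding psi_prod using that by (intro norm_prod_le_power) (auto simp: norm_lam_power)
  qed
  have crude: "norm (Omega lam \<phi> n z) \<le> M ^ n" if "z \<in> unit_disc" for n z
    unfolding Omega_eq psi_prod using that
    by (intro norm_prod_le_power M(2)) (simp add: norm_lam_power)
  obtain K where K: "compact K" "K \<subseteq> unit_disc"
    and large: "\<forall>C::real. \<exists>n\<ge>1. \<exists>z\<in>K. ennreal C < ennreal (norm (Omega lam \<phi> n z))"
    using not_unif_bounded_on_compactsE[OF unbounded] .
  \<comment> \<open>The summand \<open>real k\<close> gives unboundedness along the chosen indices.
    The summand \<open>M ^ k\<close> forces the index to be at least \<open>k\<close>, since
    \<open>crude\<close> bounds \<open>Omega\<close> by \<open>M ^ n\<close>.\<close>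
  have "\<exists>n. \<exists>z\<in>K. norm (Omega lam \<phi> n z) > real k + M ^ k" for k
  proof -
    have "0 \<le> real k + M ^ k" using M(1) by simp
    then show ?thesis
      using large[rule_format, of "real k + M ^ k"] by (metis ennreal_less_iff)
  qed
  then obtain N z where N: "\<And>k. z k \<in> K" "\<And>k. norm (Omega lam \<phi> (N k) (z k)) > real k + M ^ k"
    by metis
  have Nk: "N k \<ge> k" for k
  proof (rule ccontr)
    assume "\<not> N k \<ge> k"
    then have "M ^ N k \<le> M ^ k" using M(1) by (intro power_increasing) auto
    then show False using crude[of "z k" "N k"] N[of k] K(2) by force
  qed
  show ?thesis
  proof (rule hypercyclic_criterion[of N])
    fix h y B
    assume h: "\<And>k. norm (h k) \<le> B" "\<And>k. norm ((S ^^ N k) (h k)) \<le> B"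
    have B: "B \<ge> 0" using h(1)[of 0] norm_ge_zero order_trans by blast
    show "(\<lambda>k. inner ((S ^^ N k) (h k)) y) \<longlonglongrightarrow> 0"
    \<comment> \<open>Near 0 the product of the \<open>N k\<close> symbol factors is at most
      \<open>q ^ N k\<close>, while \<open>h k\<close> is bounded there.\<close>
    proof (rule weakly_null_if_null_near_0[OF h(2) \<rho>(1,2)])
      show "(\<lambda>k. q ^ k * (B / (1 - \<rho>))) \<longlonglongrightarrow> 0"
        using q q0 by (intro tendsto_mult_left_zero LIMSEQ_realpow_zero)
      show "norm (h2_fun ((S ^^ N k) (h k)) z) \<le> q ^ k * (B / (1 - \<rho>))" if z: "norm z \<le> \<rho>" for k z
      proof -
        have "norm (h2_fun ((S ^^ N k) (h k)) z) = norm (psi_prod (N k) z) * norm (h2_fun (h k) (cnj lam ^ N k * z))"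
          using z \<rho> by (simp add: S_power norm_mult)
        also have "\<dots> \<le> q ^ N k * (B / (1 - \<rho>))"
          using z \<rho> q0 by (intro mult_mono small h2_fun_le h) (auto simp: norm_lam_power)
        also have "\<dots> \<le> q ^ k * (B / (1 - \<rho>))"
          using q q0 \<rho> B Nk by (intro mult_right_mono power_decreasing) auto
        finally show ?thesis .
      qed
    qed
    show "(\<lambda>k. inner (h k) y) \<longlonglongrightarrow> 0"
    proof (rule weakly_null_if_multiplier_unbounded[OF h(1) Omega_holomorphic K])
      show "\<exists>z\<in>K. norm (Omega lam \<phi> (N k) z) \<ge> real k" for k
      proof (rule bexI[of _ "z k"])
        have "0 \<le> M ^ k" using M(1) by simp
        then show "norm (Omega lam \<phi> (N k) (z k)) \<ge> real k" using N(2)[of k] by linarith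
      qed (rule N)
      show "\<exists>C. \<forall>k z. norm z = \<rho> \<longrightarrow> norm (Omega lam \<phi> (N k) z * h2_fun (h k) z) \<le> C" if "\<rho> < 1" for \<rho>
      proof (intro exI[of _ "B / (1 - \<rho>)"] allI impI)
        fix k and z :: complex
        assume z: "norm z = \<rho>"
        then have "norm (h2_fun ((S ^^ N k) (h k)) (lam ^ N k * z)) \<le> B / (1 - \<rho>)"
          using that by (intro h2_fun_le h) (auto simp: norm_lam_power)
        then show "norm (Omega lam \<phi> (N k) z * h2_fun (h k) z) \<le> B / (1 - \<rho>)"
          using z that by (simp add: S_power_rotated)
      qed
    qed
  qed
qed

section \<open>The case of an expanding value at 0\<close>

text \<open>Near 0 the modulus of \<open>Omega\<close> is at least \<open>q ^ n\<close> with
  \<open>q > 1\<close>, whereas its product with \<open>h k\<close> stays bounded, so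
  \<open>h k\<close> decays like \<open>(1 / q) ^ k\<close>. This half of the criterion is shared by
  symbols with and without zeros.\<close>

lemma preimage_null_if_expanding_at_0:
  assumes greater: "norm (\<phi> 0) > 1" and Nk: "\<And>k. N k \<ge> k"
    and h: "\<And>k. norm (h k) \<le> B" "\<And>k. norm ((S ^^ N k) (h k)) \<le> B"
  shows "(\<lambda>k. inner (h k) y) \<longlonglongrightarrow> 0"
proof -
  obtain q where q: "1 < q" "q < norm (\<phi> 0)" using dense[OF greater] by blast
  obtain \<rho> where \<rho>: "0 < \<rho>" "\<rho> < 1" "\<And>z. norm z \<le> \<rho> \<Longrightarrow> psi z \<in> - cball 0 q"
    using psi_near_0[of "- cball 0 q"] q(2) by (auto simp: conj_symbol_def open_Compl)
  have large: "q ^ n \<le> norm (Omega lam \<phi> n z)" if "norm z \<le> \<rho>" for n z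
  proof -
    have "q \<le> norm (psi w)" if "norm w \<le> \<rho>" for w using \<rho>(3)[OF that] by simp
    then show ?thesis
      unfolding Omega_eq psi_prod using that q(1)
      by (intro norm_prod_ge_power) (auto simp: norm_lam_power)
  qed
  have B: "B \<ge> 0" using h(1)[of 0] norm_ge_zero order_trans by blast
  show ?thesis
  proof (rule weakly_null_if_null_near_0[OF h(1) \<rho>(1,2)])
    show "(\<lambda>k. (1 / q) ^ k * (B / (1 - \<rho>))) \<longlonglongrightarrow> 0"
      using q by (intro tendsto_mult_left_zero LIMSEQ_realpow_zero) auto
    show "norm (h2_fun (h k) z) \<le> (1 / q) ^ k * (B / (1 - \<rho>))" if z: "norm z \<le> \<rho>" for k z
    proof -
      have "norm (h2_fun (h k) z) * q ^ k \<le> norm (h2_fun (h k) z) * norm (Omega lam \<phi> (N k) z)"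
      proof (rule mult_left_mono)
        have "q ^ k \<le> q ^ N k" using q Nk by (intro power_increasing) auto
        also have "\<dots> \<le> norm (Omega lam \<phi> (N k) z)" by (rule large[OF z])
        finally show "q ^ k \<le> norm (Omega lam \<phi> (N k) z)" .
      qed simp
      also have "\<dots> = norm (h2_fun ((S ^^ N k) (h k)) (lam ^ N k * z))"
        using z \<rho> by (simp add: S_power_rotated norm_mult)
      also have "\<dots> \<le> B / (1 - \<rho>)"
        using z \<rho> by (intro h2_fun_le h) (auto simp: norm_lam_power)
      finally have "norm (h2_fun (h k) z) \<le> B / (1 - \<rho>) / q ^ k"
        using q by (subst pos_le_divide_eq) auto
      then show ?thesis by (simp add: power_one_over mult.commute)
    qed
  qed
qed

text \<open>All indices \<open>N k = k\<close> work. The conjugate of \<open>a\<close> is a zero of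
  \<open>psi\<close>, so \<open>S ^^ n\<close> produces functions vanishing at the first
  \<open>n\<close> points of its orbit under rotation by \<open>lam\<close>. A limit vanishes on the
  whole orbit, which is infinite by irrationality and lies on one circle inside the disc, so the
  limit is 0.\<close>

lemma hypercyclic_if_zero:
  assumes irr: "irrational_rotation lam" and greater: "norm (\<phi> 0) > 1"
    and a: "a \<in> unit_disc" "\<phi> a = 0"
  shows "hypercyclic T"
proof (rule hypercyclic_criterion[of "\<lambda>k. k"])
  fix h y B
  assume h: "\<And>k. norm (h k) \<le> B" "\<And>k. norm ((S ^^ k) (h k)) \<le> B"
  show "(\<lambda>k. inner (h k) y) \<longlonglongrightarrow> 0"
    by (rule preimage_null_if_expanding_at_0[OF greater _ h]) simp
  show "(\<lambda>k. inner ((S ^^ k) (h k)) y) \<longlonglongrightarrow> 0"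
  proof (rule weakly_null_if_limits_zero[OF h(2)])
    fix r :: "nat \<Rightarrow> nat" and g z
    assume r: "strict_mono r" and g: "g holomorphic_on unit_disc" and z: "z \<in> unit_disc"
      and lim: "\<And>K. compact K \<Longrightarrow> K \<subseteq> unit_disc \<Longrightarrow>
        uniform_limit K (\<lambda>k. h2_fun ((S ^^ r k) (h (r k)))) g sequentially"
    define p where "p j = lam ^ j * cnj a" for j
    have p: "norm (p j) = norm a" for j by (simp add: p_def norm_lam_power)
    have gp: "g (p j) = 0" for j
    proof (rule LIMSEQ_unique)
      show "(\<lambda>k. h2_fun ((S ^^ r k) (h (r k))) (p j)) \<longlonglongrightarrow> g (p j)"
        using a(1) by (intro tendsto_uniform_limitI[OF lim[of "{p j}"]]) (auto simp: p)
      \<comment> \<open>The factor that vanishes at \<open>p j\<close> has index \<open>j\<close>,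
        so it occurs in \<open>psi_prod (r k)\<close> only if \<open>j < r k\<close>.\<close>
      have "h2_fun ((S ^^ r k) (h (r k))) (p j) = 0" if "k > j" for k
      proof -
        have "j < r k" using that strict_mono_imp_increasing[OF r, of k] by simp
        moreover have "psi (cnj lam ^ j * p j) = 0"
          using a(2) by (simp add: p_def cnj_lam_power conj_symbol_def)
        ultimately have "psi_prod (r k) (p j) = 0" unfolding psi_prod by (intro prod_zero) auto
        then show ?thesis using a(1) by (simp add: S_power p)
      qed
      then have "eventually (\<lambda>k. h2_fun ((S ^^ r k) (h (r k))) (p j) = 0) sequentially"
        by (auto intro: eventually_mono[OF eventually_gt_at_top[of j]])
      then show "(\<lambda>k. h2_fun ((S ^^ r k) (h (r k))) (p j)) \<longlonglongrightarrow> 0"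
        by (rule tendsto_eventually)
    qed
    \<comment> \<open>The zero is not at the origin because \<open>|\<phi> 0| > 1\<close>; otherwise
      its orbit would be a single point.\<close>
    have "a \<noteq> 0" using a greater by auto
    then have "inj p"
      using irrational_rotation_power_inj[OF irr] by (auto simp: p_def inj_def)
    then have "infinite (range p)" by (simp add: finite_image_iff)
    moreover have "range p \<subseteq> {w \<in> cball 0 (norm a). g w = 0}" using p gp by auto
    ultimately have "infinite {w \<in> cball 0 (norm a). g w = 0}" by (metis finite_subset)
    have "g constant_on unit_disc"
    proof (rule ccontr)
      assume "\<not> g constant_on unit_disc"
      moreover have "cball 0 (norm a) \<subseteq> (unit_disc :: complex set)" using a(1) by auto
      ultimately have "finite {w \<in> cball 0 (norm a). g w = 0}"
        using holomorphic_compact_finite_zeros[OF g open_ball connected_ball compact_cball] by blast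
      then show False using \<open>infinite {w \<in> cball 0 (norm a). g w = 0}\<close> by blast
    qed
    then obtain c where c: "\<And>w. w \<in> unit_disc \<Longrightarrow> g w = c"
      by (auto simp: constant_on_def)
    have "p 0 \<in> unit_disc" using p[of 0] a(1) by simp
    then show "g z = 0" using c[OF z] c[of "p 0"] gp[of 0] by simp
  qed
qed

text \<open>Without zeros of the symbol, \<open>1 / psi_prod\<close> is holomorphic and can act as
  the unbounded multiplier, now applied to the image sequence. The product of the two is
  \<open>h k\<close> with a rotated variable, which is bounded on circles.\<close>

lemma hypercyclic_if_recip_Phi_unbounded:
  assumes unbounded: "\<not> unif_bounded_on_compacts (\<lambda>n. recip_modulus (Phi lam \<phi> n))"
    and greater: "norm (\<phi> 0) > 1" and nz: "\<And>z. z \<in> unit_disc \<Longrightarrow> \<phi> z \<noteq> 0"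
  shows "hypercyclic T"
proof -
  obtain K where K: "compact K" "K \<subseteq> unit_disc"
    and large: "\<forall>C::real. \<exists>n\<ge>1. \<exists>z\<in>K. ennreal C < recip_modulus (Phi lam \<phi> n) z"
    using not_unif_bounded_on_compactsE[OF unbounded] .
  obtain \<rho> where \<rho>: "0 \<le> \<rho>" "\<rho> < 1" "K \<subseteq> cball 0 \<rho>"
    using compact_subset_disc_bound[OF K] .
  have cball: "cball 0 \<rho> \<subseteq> (unit_disc :: complex set)" using \<rho> by auto
  \<comment> \<open>The points \<open>lam ^ j * z\<close> may leave \<open>K\<close>, but they stay
    in the disc \<open>cball 0 \<rho>\<close>, so the minimum of \<open>|\<phi>|\<close> is taken
    there.\<close>
  have "\<exists>w\<in>cball 0 \<rho>. \<forall>v\<in>cball 0 \<rho>. norm (\<phi> w) \<le> norm (\<phi> v)"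
    using \<rho> by (intro continuous_attains_inf continuous_on_norm holomorphic_on_imp_continuous_on
        holomorphic_on_subset[OF phi_holomorphic cball]) auto
  then obtain w where w: "w \<in> cball 0 \<rho>" "\<And>v. v \<in> cball 0 \<rho> \<Longrightarrow> norm (\<phi> w) \<le> norm (\<phi> v)" by blast
  define m where "m = min 1 (norm (\<phi> w))"
  have m: "0 < m" "m \<le> 1" using nz[of w] w(1) cball by (auto simp: m_def)
  have Phi_nz: "Phi lam \<phi> n z \<noteq> 0" if "z \<in> unit_disc" for n z
    unfolding Phi_def using that nz by (auto simp: prod_zero_iff norm_lam_power)
  have crude: "m ^ n \<le> norm (Phi lam \<phi> n z)" if "z \<in> K" for n z
    unfolding Phi_def
  proof (rule norm_prod_ge_power)
    show "m \<le> norm (\<phi> (lam ^ j * z))" for j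
      using w(2)[of "lam ^ j * z"] that \<rho>(3) by (auto simp: m_def norm_lam_power)
  qed (use m in simp)
  \<comment> \<open>\<open>(1 / m) ^ k\<close> again forces the index to be at least
    \<open>k\<close>, since \<open>crude\<close> bounds \<open>1 / |Phi|\<close> by
    \<open>(1 / m) ^ n\<close> on \<open>K\<close> and \<open>m \<le> 1\<close>.\<close>
  have "\<exists>n. \<exists>z\<in>K. 1 / norm (Phi lam \<phi> n z) > real k + (1 / m) ^ k" for k
  proof -
    obtain n z where z: "z \<in> K" "ennreal (real k + (1 / m) ^ k) < recip_modulus (Phi lam \<phi> n) z"
      using large by blast
    have "recip_modulus (Phi lam \<phi> n) z = ennreal (1 / norm (Phi lam \<phi> n z))"
      using Phi_nz[of z n] z(1) K(2) by (auto simp: recip_modulus_def inverse_ennreal divide_inverse)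
    moreover have "0 \<le> real k + (1 / m) ^ k" using m by simp
    ultimately show ?thesis using z by (metis ennreal_less_iff)
  qed
  then obtain N z where N: "\<And>k. z k \<in> K" "\<And>k. 1 / norm (Phi lam \<phi> (N k) (z k)) > real k + (1 / m) ^ k"
    by metis
  have Nk: "N k \<ge> k" for k
  proof (rule ccontr)
    assume "\<not> N k \<ge> k"
    have "1 / norm (Phi lam \<phi> (N k) (z k)) \<le> 1 / m ^ N k"
      using crude[OF N(1)] m by (intro divide_left_mono) (auto intro!: mult_pos_pos less_le_trans[OF _ crude[OF N(1)]])
    also have "\<dots> \<le> (1 / m) ^ k"
      unfolding power_one_over[symmetric] using m \<open>\<not> N k \<ge> k\<close> by (intro power_increasing) auto
    finally show False using N(2)[of k] by simp
  qed
  define F where "F k z = 1 / psi_prod (N k) z" for k z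
  have psi_prod_nz: "psi_prod n z \<noteq> 0" if "z \<in> unit_disc" for n z
    using Phi_nz[of "cnj z" n] that by (simp add: conj_symbol_def)
  show ?thesis
  proof (rule hypercyclic_criterion[of N])
    fix h y B
    assume h: "\<And>k. norm (h k) \<le> B" "\<And>k. norm ((S ^^ N k) (h k)) \<le> B"
    show "(\<lambda>k. inner (h k) y) \<longlonglongrightarrow> 0"
      by (rule preimage_null_if_expanding_at_0[OF greater Nk h])
    show "(\<lambda>k. inner ((S ^^ N k) (h k)) y) \<longlonglongrightarrow> 0"
    \<comment> \<open>The compact set is conjugated because \<open>psi_prod\<close> at
      \<open>cnj z\<close> is the conjugate of \<open>Phi\<close> at \<open>z\<close>.\<close>
    proof (rule weakly_null_if_multiplier_unbounded[where F = F and K = "cnj ` K", OF h(2)])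
      show "F k holomorphic_on unit_disc" for k
        unfolding F_def[abs_def] using psi_prod_nz by (intro holomorphic_intros psi_prod_holomorphic)
      show "compact (cnj ` K)" using K(1) by (intro compact_continuous_image continuous_intros)
      show "cnj ` K \<subseteq> unit_disc" using K(2) by auto
      show "\<exists>z\<in>cnj ` K. real k \<le> norm (F k z)" for k
      proof (rule bexI[of _ "cnj (z k)"])
        have "(1 / m) ^ k \<ge> 0" using m by simp
        then show "real k \<le> norm (F k (cnj (z k)))"
          using N(2)[of k] by (simp add: F_def conj_symbol_def norm_divide)
      qed (use N in auto)
      show "\<exists>C. \<forall>k z. norm z = \<rho> \<longrightarrow> norm (F k z * h2_fun ((S ^^ N k) (h k)) z) \<le> C" if "\<rho> < 1" for \<rho>
      proof (intro exI[of _ "B / (1 - \<rho>)"] allI impI)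
        fix k and z :: complex
        assume z: "norm z = \<rho>"
        then have "norm (h2_fun (h k) (cnj lam ^ N k * z)) \<le> B / (1 - \<rho>)"
          using that by (intro h2_fun_le h) (auto simp: norm_lam_power)
        then show "norm (F k z * h2_fun ((S ^^ N k) (h k)) z) \<le> B / (1 - \<rho>)"
          using z that psi_prod_nz[of z "N k"] by (simp add: S_power F_def)
      qed
    qed
  qed
qed

end

theorem theorem4p16:
  fixes lam :: complex and \<phi> :: "complex \<Rightarrow> complex" and T :: "hardy2 \<Rightarrow> hardy2"
  assumes "irrational_rotation lam"
    and "\<phi> \<in> H_infinity" and "\<exists>z\<in>unit_disc. \<phi> z \<noteq> 0"
    and "T = rotation_op lam \<circ> backward_shift_calculus \<phi>"
  shows "(\<not> unif_bounded_on_compacts (\<lambda>n z. ennreal (norm (Omega lam \<phi> n z))) \<and> norm (\<phi> 0) < 1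
            \<longrightarrow> hypercyclic T)
       \<and> (\<not> unif_bounded_on_compacts (\<lambda>n. recip_modulus (Phi lam \<phi> n)) \<and> norm (\<phi> 0) > 1
            \<longrightarrow> hypercyclic T)"
proof -
  interpret rotated_symbol lam \<phi>
    using assms(1,2) irrational_rotation_norm by unfold_locales
  have T_eq: "T = rotated_symbol.T lam \<phi>"
    using assms(4) T_def by simp
  \<comment> \<open>The second claim splits according to whether \<open>\<phi>\<close> has a zero in
    the disc.\<close>
  show ?thesis
    unfolding T_eq using hypercyclic_if_Omega_unbounded hypercyclic_if_recip_Phi_unbounded
      hypercyclic_if_zero[OF assms(1)] by blast
qed

end
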